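(* Let $A$ be a fixed graph on $s=O(1)$ vertices and let $G$ be a graph with $m$ edges, received as an edge stream, containing $M$ copies of $A$ (subgraphs of $G$ isomorphic to $A$). For $\ell\in\{1,\dots,s\}$ let $f_\ell$ be the fraction of pairs of copies of $A$ in $G$ that intersect at $\ell$ vertices. There is a sampling algorithm that finds a $(1+\epsilon)$-factor approximation to $M$ with probability $1-\delta$, using order \[ m\,\frac{\log(1/\delta)}{\epsilon^2}\,\log M\left(\sum_{\ell=2}^{s} f_\ell^{2/\ell}+f_\ell^{\frac{1}{\ell-1}}f_1^{1-\frac{1}{\ell-1}}\right) \] samples in expectation.
   Context: In the (nonadaptive) sampling model, an algorithm chooses a distribution over sets $S$ of vertex pairs independent of the input and receives $E(G)\cap S$, paying $\mathbb{E}|E(G)\cap S|$ samples. Standing convention of the paper: an algorithm whose sampling rates depend on graph parameters (such as a lower bound on $M$ and the quantities $f_\ell$) is assumed to know those parameters up to constant factors.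
   Formalization: The factor log M is read as max(1, log M), since for M = 1 the literal bound would be zero samples, which is impossible; M ≥ 1 is assumed so that the fractions f_ℓ are defined, and pairs of copies are ordered pairs that include a copy paired with itself. *)

theory Defs
  imports "HOL-Probability.Probability" "HOL-Library.Ramsey"
begin

type_synonym 'a ugraph = "'a set \<times> 'a set set"

abbreviation vertices :: "'a ugraph \<Rightarrow> 'a set" where
  "vertices G \<equiv> fst G"

abbreviation edges :: "'a ugraph \<Rightarrow> 'a set set" where
  "edges G \<equiv> snd G"

definition simple_graph :: "'a ugraph \<Rightarrow> bool" where
  "simple_graph G \<longleftrightarrow> finite (vertices G) \<and> edges G \<subseteq> [vertices G]\<^bsup>2\<^esup>"

definition subgraph_of :: "'a ugraph \<Rightarrow> 'a ugraph \<Rightarrow> bool" where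
  "subgraph_of H G \<longleftrightarrow> simple_graph H \<and> vertices H \<subseteq> vertices G \<and> edges H \<subseteq> edges G"

definition graph_iso :: "'a ugraph \<Rightarrow> 'b ugraph \<Rightarrow> bool" where
  "graph_iso A H \<longleftrightarrow>
     (\<exists>\<phi>. bij_betw \<phi> (vertices A) (vertices H) \<and>
          (\<forall>u\<in>vertices A. \<forall>v\<in>vertices A. {u, v} \<in> edges A \<longleftrightarrow> {\<phi> u, \<phi> v} \<in> edges H))"

text \<open>Copies are not necessarily induced subgraphs, and are counted as subgraphs,
  not as embeddings.\<close>

definition copies :: "'a ugraph \<Rightarrow> 'v ugraph \<Rightarrow> 'v ugraph set" where
  "copies A G = {H. subgraph_of H G \<and> graph_iso A H}"

definition num_copies :: "'a ugraph \<Rightarrow> 'v ugraph \<Rightarrow> nat" where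
  "num_copies A G = card (copies A G)"

text \<open>The fraction \<open>f\<^sub>\<ell>\<close> is taken over all ordered pairs of copies, a copy paired with
  itself included (so \<open>f\<^sub>s \<ge> 1 / M\<close>).\<close>

definition overlap_frac :: "'a ugraph \<Rightarrow> 'v ugraph \<Rightarrow> nat \<Rightarrow> real" where
  "overlap_frac A G l =
     real (card {(H, H'). H \<in> copies A G \<and> H' \<in> copies A G \<and>
                          card (vertices H \<inter> vertices H') = l})
     / (real (num_copies A G))\<^sup>2"

text \<open>Real power with the convention \<open>0\<^sup>0 = 1\<close>; the library has \<open>0 powr 0 = 0\<close>.\<close>

definition rpow :: "real \<Rightarrow> real \<Rightarrow> real" where
  "rpow x a = (if a = 0 then 1 else x powr a)"

text \<open>A nonadaptive sampling algorithm on the vertex set \<open>V\<close> draws, independently of the edges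
  of the input, a set \<open>S\<close> of vertex pairs together with a post-processing function \<open>g\<close>
  (which carries whatever further internal randomness it shares with \<open>S\<close>).
  On input \<open>G\<close> it receives \<open>edges G \<inter> S\<close> and outputs \<open>g (edges G \<inter> S)\<close>.\<close>

type_synonym 'v sampler = "('v set set \<times> ('v set set \<Rightarrow> real)) pmf"

definition sampling_algorithm :: "'v set \<Rightarrow> 'v sampler \<Rightarrow> bool" where
  "sampling_algorithm V D \<longleftrightarrow> (\<forall>(S, g)\<in>set_pmf D. S \<subseteq> [V]\<^bsup>2\<^esup>)"

definition sampler_output :: "'v sampler \<Rightarrow> 'v ugraph \<Rightarrow> real pmf" where
  "sampler_output D G = map_pmf (\<lambda>(S, g). g (edges G \<inter> S)) D"

definition expected_samples :: "'v sampler \<Rightarrow> 'v ugraph \<Rightarrow> real" where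
  "expected_samples D G = measure_pmf.expectation D (\<lambda>(S, g). real (card (edges G \<inter> S)))"



definition within_factor :: "real \<Rightarrow> real \<Rightarrow> real \<Rightarrow> bool" where
  "within_factor c x y \<longleftrightarrow> y / c \<le> x \<and> x \<le> c * y"

end

theory Submission
  imports Defs
begin

text \<open>Discard each vertex with probability \<open>1 - q\<close>, colour the remaining ones uniformly with \<open>N\<close>
  colours, and sample the pairs whose endpoints received the same colour. A pair is sampled at rate
  \<open>q\<^sup>2 / N\<close>, a copy of \<open>A\<close> is entirely monochromatic with probability \<open>N (q / N)\<^sup>s\<close>, and two copies sharing
  \<open>l \<ge> 1\<close> vertices are positively correlated by a factor \<open>1 / (N (q / N)\<^sup>l)\<close>, while disjoint
  copies are uncorrelated. So the normalised number of monochromatic copies has bounded relative variance as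
  soon as \<open>f\<^sub>l \<le> N (q / N)\<^sup>l\<close> for all \<open>l \<ge> 1\<close>; the best \<open>q\<close> and \<open>N\<close> give the two kinds of
  terms of the bound. A median of means of independent repetitions yields accuracy \<open>\<epsilon>\<close> and
  failure probability \<open>\<delta>\<close>. If \<open>\<epsilon>\<close> is not small compared to \<open>K\<close>, the advice \<open>M'\<close> is itself a
  sufficient answer.\<close>

section \<open>Independent repetitions\<close>

lemma finite_set_Pi_pmf:
  assumes "finite A" and "\<And>x. x \<in> A \<Longrightarrow> finite (set_pmf (p x))"
  shows "finite (set_pmf (Pi_pmf A d p))"
  using assms by (auto simp: set_Pi_pmf)

lemma expectation_Pi_pmf_component:
  fixes h :: "'b \<Rightarrow> real"
  assumes "finite A" and "x \<in> A"
  shows "measure_pmf.expectation (Pi_pmf A d p) (\<lambda>\<omega>. h (\<omega> x)) = measure_pmf.expectation (p x) h"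
proof -
  have "measure_pmf.expectation (p x) h
      = measure_pmf.expectation (map_pmf (\<lambda>\<omega>. \<omega> x) (Pi_pmf A d p)) h"
    using assms by (simp add: Pi_pmf_component)
  then show ?thesis by simp
qed

text \<open>Variance of a sum of independent centred variables. Splitting off one coordinate with
  value \<open>a\<close>, the cross term \<open>2 * W a * ?T \<omega>\<close> has expectation 0,
  because the remaining sum is centred. Finite support makes every function integrable.\<close>

lemma expectation_square_sum_Pi_pmf:
  fixes P :: "'b pmf" and W :: "'b \<Rightarrow> real"
  assumes "finite I" and fin: "finite (set_pmf P)" and mean: "measure_pmf.expectation P W = 0"
  shows "measure_pmf.expectation (Pi_pmf I d (\<lambda>_. P)) (\<lambda>\<omega>. (\<Sum>i\<in>I. W (\<omega> i))\<^sup>2)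
       = real (card I) * measure_pmf.expectation P (\<lambda>b. (W b)\<^sup>2)"
  using \<open>finite I\<close>
proof (induction I rule: finite_induct)
  case empty
  then show ?case by simp
next
  case (insert x I)
  let ?Q = "Pi_pmf I d (\<lambda>_. P)"
  let ?T = "\<lambda>\<omega>. \<Sum>i\<in>I. W (\<omega> i)"
  have finQ: "finite (set_pmf ?Q)"
    using insert fin by (simp add: finite_set_Pi_pmf)
  have int: "integrable (measure_pmf ?Q) h" for h :: "_ \<Rightarrow> real"
    by (rule integrable_measure_pmf_finite[OF finQ])
  have ET: "measure_pmf.expectation ?Q ?T = 0"
    using insert by (simp add: int expectation_Pi_pmf_component mean)
  have sum_upd: "(\<Sum>i\<in>insert x I. W (fun_upd \<omega> x a i)) = W a + ?T \<omega>" for \<omega> a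
    using insert by (auto intro!: sum.cong)
  have "measure_pmf.expectation (Pi_pmf (insert x I) d (\<lambda>_. P)) (\<lambda>\<omega>. (\<Sum>i\<in>insert x I. W (\<omega> i))\<^sup>2)
      = (\<Sum>a\<in>set_pmf P. pmf P a *
          measure_pmf.expectation (map_pmf (\<lambda>\<omega>. fun_upd \<omega> x a) ?Q) (\<lambda>\<omega>. (\<Sum>i\<in>insert x I. W (\<omega> i))\<^sup>2))"
    using insert fin finQ
    by (simp add: Pi_pmf_insert' pmf_expectation_bind[of "set_pmf P"] map_pmf_def[symmetric])
  also have "\<dots> = (\<Sum>a\<in>set_pmf P. pmf P a * measure_pmf.expectation ?Q (\<lambda>\<omega>. (W a + ?T \<omega>)\<^sup>2))"
    by (simp only: integral_map_pmf sum_upd)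
  also have "\<dots> = (\<Sum>a\<in>set_pmf P. pmf P a * ((W a)\<^sup>2 + real (card I) * measure_pmf.expectation P (\<lambda>b. (W b)\<^sup>2)))"
    using insert.IH ET by (simp add: power2_sum int algebra_simps)
  also have "\<dots> = measure_pmf.expectation P (\<lambda>b. (W b)\<^sup>2)
      + real (card I) * measure_pmf.expectation P (\<lambda>b. (W b)\<^sup>2)"
    using fin
    by (subst integral_measure_pmf[of "set_pmf P" P "\<lambda>b. (W b)\<^sup>2"])
       (auto simp: distrib_left sum.distrib sum_distrib_right[symmetric] sum_pmf_eq_1)
  finally show ?case using insert by (simp add: algebra_simps)
qed

text \<open>Chebyshev's inequality: the second-moment hypothesis bounds the variance of one
  \<open>Z\<close> by \<open>v * \<mu>\<^sup>2\<close>, and averaging \<open>n\<close> independent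
  copies divides it by \<open>n\<close>.\<close>

lemma prob_sample_mean_deviation:
  fixes P :: "'b pmf" and Z :: "'b \<Rightarrow> real"
  assumes fin: "finite (set_pmf P)" and mean: "measure_pmf.expectation P Z = \<mu>"
    and var: "measure_pmf.expectation P (\<lambda>b. (Z b)\<^sup>2) \<le> (1 + v) * \<mu>\<^sup>2"
    and "\<mu> > 0" "\<eta> > 0" "n > 0"
  shows "measure_pmf.prob (Pi_pmf {..<n} d (\<lambda>_. P)) {\<omega>. \<bar>(\<Sum>i<n. Z (\<omega> i)) / real n - \<mu>\<bar> \<ge> \<eta> * \<mu>}
       \<le> v / (real n * \<eta>\<^sup>2)"
proof -
  let ?Q = "Pi_pmf {..<n} d (\<lambda>_. P)"
  let ?W = "\<lambda>b. Z b - \<mu>"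
  have finQ: "finite (set_pmf ?Q)" using fin by (simp add: finite_set_Pi_pmf)
  have intP: "integrable (measure_pmf P) h" for h :: "_ \<Rightarrow> real"
    by (rule integrable_measure_pmf_finite[OF fin])
  have EW: "measure_pmf.expectation P ?W = 0"
    using mean by (simp add: intP)
  have EW2: "measure_pmf.expectation P (\<lambda>b. (?W b)\<^sup>2) \<le> v * \<mu>\<^sup>2"
    using mean var by (simp add: power2_diff intP algebra_simps power2_eq_square)
  have eq: "(\<Sum>i<n. Z (\<omega> i)) / real n - \<mu> = (\<Sum>i<n. ?W (\<omega> i)) / real n" for \<omega>
    using \<open>n > 0\<close> by (simp add: sum_subtractf field_simps)
  have "measure_pmf.prob ?Q {\<omega>. \<bar>(\<Sum>i<n. Z (\<omega> i)) / real n - \<mu>\<bar> \<ge> \<eta> * \<mu>}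
      = measure_pmf.prob ?Q {\<omega>\<in>space (measure_pmf ?Q). \<bar>(\<Sum>i<n. ?W (\<omega> i)) / real n\<bar> \<ge> \<eta> * \<mu>}"
    by (simp add: eq)
  also have "\<dots> \<le> measure_pmf.expectation ?Q (\<lambda>\<omega>. ((\<Sum>i<n. ?W (\<omega> i)) / real n)\<^sup>2) / (\<eta> * \<mu>)\<^sup>2"
    using assms
    by (intro measure_pmf.second_moment_method) (auto intro!: integrable_measure_pmf_finite finQ)
  also have "\<dots> = real n * measure_pmf.expectation P (\<lambda>b. (?W b)\<^sup>2) / (real n)\<^sup>2 / (\<eta> * \<mu>)\<^sup>2"
    using expectation_square_sum_Pi_pmf[of "{..<n}" P ?W d] fin EW by (simp add: power_divide)
  also have "\<dots> \<le> real n * (v * \<mu>\<^sup>2) / (real n)\<^sup>2 / (\<eta> * \<mu>)\<^sup>2"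
    using EW2 by (intro divide_right_mono mult_left_mono) auto
  also have "\<dots> = v / (real n * \<eta>\<^sup>2)"
    using assms by (simp add: power2_eq_square field_simps)
  finally show ?thesis .
qed

text \<open>Markov's inequality for \<open>16\<close> raised to the number of bad coordinates.\<close>

lemma prob_half_bad_le:
  fixes P :: "'b pmf"
  assumes fin: "finite (set_pmf P)" and bad: "measure_pmf.prob P B \<le> 1 / 16"
  shows "measure_pmf.prob (Pi_pmf {..<r} d (\<lambda>_. P)) {\<omega>. r \<le> 2 * card {i\<in>{..<r}. \<omega> i \<in> B}} \<le> (1 / 2) ^ r"
proof -
  let ?Q = "Pi_pmf {..<r} d (\<lambda>_. P)"
  \<comment> \<open>\<open>?h\<close> is 16 on \<open>B\<close> and 1 elsewhere, so its mean is at
    most \<open>1 + 15 / 16 \<le> 2\<close>. If at least half of the coordinates are bad, the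
    product is at least \<open>4 ^ r\<close>; Markov's inequality then gives
    \<open>(2 / 4) ^ r\<close>.\<close>
  let ?h = "\<lambda>b. 1 + 15 * indicator B b :: real"
  have prod: "(\<Prod>i<r. ?h (\<omega> i)) = 16 ^ card {i\<in>{..<r}. \<omega> i \<in> B}" for \<omega>
  proof -
    have "(\<Prod>i<r. ?h (\<omega> i)) = (\<Prod>i<r. if \<omega> i \<in> B then 16 else 1)"
      by (intro prod.cong) (auto simp: indicator_def)
    also have "\<dots> = (\<Prod>i\<in>{i\<in>{..<r}. \<omega> i \<in> B}. 16)"
      by (rule prod.inter_filter[symmetric]) simp
    finally show ?thesis by simp
  qed
  have finQ: "finite (set_pmf ?Q)" using fin by (simp add: finite_set_Pi_pmf)
  have "(4::real) ^ r \<le> 16 ^ k" if "r \<le> 2 * k" for k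
  proof -
    have "(4::real) ^ r \<le> 4 ^ (2 * k)" using that by (intro power_increasing) auto
    then show ?thesis by (simp add: power_mult)
  qed
  then have "measure_pmf.prob ?Q {\<omega>. r \<le> 2 * card {i\<in>{..<r}. \<omega> i \<in> B}}
     \<le> measure_pmf.prob ?Q {\<omega>\<in>space (measure_pmf ?Q). (\<Prod>i<r. ?h (\<omega> i)) \<ge> 4 ^ r}"
    unfolding prod by (intro measure_pmf.finite_measure_mono) auto
  also have "\<dots> \<le> measure_pmf.expectation ?Q (\<lambda>\<omega>. \<Prod>i<r. ?h (\<omega> i)) / 4 ^ r"
    by (intro integral_Markov_inequality_measure[where A = "{}"])
       (auto intro!: integrable_measure_pmf_finite finQ prod_nonneg AE_pmfI)
  also have "measure_pmf.expectation ?Q (\<lambda>\<omega>. \<Prod>i<r. ?h (\<omega> i))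
      = (\<Prod>i<r. measure_pmf.expectation P ?h)"
    by (subst expectation_prod_Pi_pmf[where f = "\<lambda>_. ?h"])
       (auto intro!: integrable_measure_pmf_finite fin)
  also have "measure_pmf.expectation P ?h = 1 + 15 * measure_pmf.prob P B"
    by (simp add: integrable_measure_pmf_finite fin)
  also have "(\<Prod>i<r. 1 + 15 * measure_pmf.prob P B) \<le> (\<Prod>i<r. 2)"
    using bad by (intro prod_mono) auto
  finally show ?thesis by (simp add: divide_right_mono flip: power_divide)
qed

section \<open>Random colourings\<close>

text \<open>Colour \<open>0\<close> means that a vertex is discarded; each of the colours \<open>1, \<dots>, N\<close> has
  probability \<open>q / N\<close>.\<close>

definition colour_pmf :: "real \<Rightarrow> nat \<Rightarrow> nat pmf" where
  "colour_pmf q N = bernoulli_pmf q \<bind> (\<lambda>b. if b then pmf_of_set {1..N} else return_pmf 0)"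

definition colouring_pmf :: "'v set \<Rightarrow> real \<Rightarrow> nat \<Rightarrow> ('v \<Rightarrow> nat) pmf" where
  "colouring_pmf V q N = Pi_pmf V 0 (\<lambda>_. colour_pmf q N)"

definition monochrome :: "nat \<Rightarrow> ('v \<Rightarrow> nat) \<Rightarrow> 'v set \<Rightarrow> bool" where
  "monochrome N c W \<longleftrightarrow> (\<exists>k\<in>{1..N}. \<forall>v\<in>W. c v = k)"

lemma monochrome_subset: "monochrome N c W \<Longrightarrow> U \<subseteq> W \<Longrightarrow> monochrome N c U"
  unfolding monochrome_def by (meson subsetD)

lemma monochrome_Un:
  assumes "monochrome N c W" "monochrome N c W'" "W \<inter> W' \<noteq> {}"
  shows "monochrome N c (W \<union> W')"
proof -
  obtain v where v: "v \<in> W" "v \<in> W'" using assms(3) by auto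
  obtain k where k: "k \<in> {1..N}" "\<forall>v\<in>W. c v = k" using assms(1) unfolding monochrome_def by auto
  obtain k' where k': "\<forall>v\<in>W'. c v = k'" using assms(2) unfolding monochrome_def by auto
  have "k' = k" using v k k' by auto
  then show ?thesis using k k' unfolding monochrome_def by auto
qed

lemma finite_set_colouring_pmf:
  assumes "finite V" and "N \<ge> 1"
  shows "finite (set_pmf (colouring_pmf V q N))"
  unfolding colouring_pmf_def colour_pmf_def
  using assms by (intro finite_set_Pi_pmf) (auto simp: set_bind_pmf)

lemma pmf_colour_pmf:
  assumes "0 \<le> q" "q \<le> 1" "k \<in> {1..N}"
  shows "pmf (colour_pmf q N) k = q / real N"
  using assms by (auto simp: colour_pmf_def pmf_bind)

text \<open>The event is a product event in which vertices outside \<open>W\<close> are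
  unconstrained and contribute the factor 1. The prescribed colour may vary with the vertex, which
  covers both one monochromatic set and two disjoint sets with different colours.\<close>

lemma prob_colouring_agrees:
  assumes "finite V" "W \<subseteq> V" "0 \<le> q" "q \<le> 1" "\<And>v. v \<in> W \<Longrightarrow> k v \<in> {1..N}"
  shows "measure_pmf.prob (colouring_pmf V q N) {c. \<forall>v\<in>W. c v = k v} = (q / real N) ^ card W"
proof -
  have "{c. \<forall>v\<in>W. c v = k v} = Pi V (\<lambda>v. if v \<in> W then {k v} else UNIV)"
    using \<open>W \<subseteq> V\<close> by (auto simp: Pi_def)
  then have "measure_pmf.prob (colouring_pmf V q N) {c. \<forall>v\<in>W. c v = k v}
      = (\<Prod>v\<in>V. measure_pmf.prob (colour_pmf q N) (if v \<in> W then {k v} else UNIV))"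
    using \<open>finite V\<close> by (simp add: colouring_pmf_def measure_Pi_pmf_Pi)
  also have "\<dots> = (\<Prod>v\<in>V. if v \<in> W then q / real N else 1)"
    using assms by (intro prod.cong) (auto simp: measure_pmf_single pmf_colour_pmf)
  also have "\<dots> = (\<Prod>v\<in>{v\<in>V. v \<in> W}. q / real N)"
    using \<open>finite V\<close> by (rule prod.inter_filter[symmetric])
  also have "{v\<in>V. v \<in> W} = W" using \<open>W \<subseteq> V\<close> by auto
  finally show ?thesis by simp
qed

lemma prob_monochrome:
  assumes "finite V" "W \<subseteq> V" "W \<noteq> {}" "0 \<le> q" "q \<le> 1"
  shows "measure_pmf.prob (colouring_pmf V q N) {c. monochrome N c W} = real N * (q / real N) ^ card W"
proof -
  have "{c. monochrome N c W} = (\<Union>k\<in>{1..N}. {c. \<forall>v\<in>W. c v = k})"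
    by (auto simp: monochrome_def)
  moreover have "disjoint_family_on (\<lambda>k. {c. \<forall>v\<in>W. c v = k}) {1..N}"
    using \<open>W \<noteq> {}\<close> by (force simp: disjoint_family_on_def)
  ultimately have "measure_pmf.prob (colouring_pmf V q N) {c. monochrome N c W}
      = (\<Sum>k\<in>{1..N}. measure_pmf.prob (colouring_pmf V q N) {c. \<forall>v\<in>W. c v = k})"
    by (simp add: measure_pmf.finite_measure_finite_Union)
  also have "\<dots> = (\<Sum>k\<in>{1..N}. (q / real N) ^ card W)"
    using assms by (intro sum.cong prob_colouring_agrees) auto
  finally show ?thesis by simp
qed

text \<open>A union bound over the pairs of colours of \<open>W\<close> and \<open>W'\<close>; the
  second-moment estimate uses only this upper bound.\<close>

lemma prob_monochrome_disjoint:
  assumes "finite V" "W \<subseteq> V" "W' \<subseteq> V" "W \<inter> W' = {}" "0 \<le> q" "q \<le> 1"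
  shows "measure_pmf.prob (colouring_pmf V q N) {c. monochrome N c W \<and> monochrome N c W'}
       \<le> (real N * (q / real N) ^ card W) * (real N * (q / real N) ^ card W')"
proof -
  let ?E = "\<lambda>(k, k'). {c. \<forall>v\<in>W \<union> W'. c v = (if v \<in> W then k else k')}"
  have fin: "finite W" "finite W'" using assms by (auto intro: finite_subset)
  have "{c. monochrome N c W \<and> monochrome N c W'} \<subseteq> (\<Union>x\<in>{1..N} \<times> {1..N}. ?E x)"
    using \<open>W \<inter> W' = {}\<close> by (fastforce simp: monochrome_def)
  then have "measure_pmf.prob (colouring_pmf V q N) {c. monochrome N c W \<and> monochrome N c W'}
      \<le> measure_pmf.prob (colouring_pmf V q N) (\<Union>x\<in>{1..N} \<times> {1..N}. ?E x)"
    by (intro measure_pmf.finite_measure_mono) auto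
  also have "\<dots> \<le> (\<Sum>x\<in>{1..N} \<times> {1..N}. measure_pmf.prob (colouring_pmf V q N) (?E x))"
    by (intro measure_pmf.finite_measure_subadditive_finite) auto
  also have "\<dots> = (\<Sum>x\<in>{1..N} \<times> {1..N}. (q / real N) ^ card (W \<union> W'))"
  proof (intro sum.cong refl)
    fix x assume "x \<in> {1..N} \<times> {1..N}"
    then show "measure_pmf.prob (colouring_pmf V q N) (?E x) = (q / real N) ^ card (W \<union> W')"
      using assms by (cases x) (simp only: prod.case, rule prob_colouring_agrees, auto)
  qed
  also have "\<dots> = (real N * (q / real N) ^ card W) * (real N * (q / real N) ^ card W')"
    using fin assms by (simp add: card_Un_disjoint power_add)
  finally show ?thesis .
qed

lemma expectation_card_filter:
  assumes "finite (set_pmf P)" "finite X"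
  shows "measure_pmf.expectation P (\<lambda>c. real (card {x\<in>X. R c x})) = (\<Sum>x\<in>X. measure_pmf.prob P {c. R c x})"
proof -
  have "real (card {x\<in>X. R c x}) = (\<Sum>x\<in>X. indicator {c. R c x} c)" for c
  proof -
    have "real (card {x\<in>X. R c x}) = (\<Sum>x\<in>{x\<in>X. R c x}. 1)" by simp
    also have "\<dots> = (\<Sum>x\<in>X. if R c x then 1 else 0)"
      using \<open>finite X\<close> by (rule sum.inter_filter)
    also have "\<dots> = (\<Sum>x\<in>X. indicator {c. R c x} c)"
      by (intro sum.cong) (auto simp: indicator_def)
    finally show ?thesis .
  qed
  then show ?thesis
    using assms by (simp add: integrable_measure_pmf_finite)
qed

lemma expectation_card_monochrome:
  assumes "finite V" "finite X" "N \<ge> 1" "0 \<le> q" "q \<le> 1" "s \<ge> 1"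
    and "\<And>x. x \<in> X \<Longrightarrow> W x \<subseteq> V \<and> card (W x) = s"
  shows "measure_pmf.expectation (colouring_pmf V q N) (\<lambda>c. real (card {x\<in>X. monochrome N c (W x)}))
       = real (card X) * (real N * (q / real N) ^ s)"
proof -
  have "measure_pmf.prob (colouring_pmf V q N) {c. monochrome N c (W x)} = real N * (q / real N) ^ s"
    if "x \<in> X" for x
    using prob_monochrome[of V "W x" q N] assms that by force
  then show ?thesis
    using assms by (simp add: expectation_card_filter finite_set_colouring_pmf)
qed

text \<open>The square counts ordered pairs of monochromatic sets; these are grouped by the size
  \<open>l\<close> of the overlap. For \<open>l \<ge> 1\<close> the common vertex forces the union
  to be monochromatic, and the overlap hypothesis is exactly what makes the class contribute at most
  the squared mean. Disjoint pairs contribute at most the same amount, so the \<open>s + 1\<close>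
  classes give the factor \<open>1 + s\<close>.\<close>

lemma second_moment_card_monochrome:
  fixes W :: "'h \<Rightarrow> 'v set"
  assumes "finite V" "finite X" "N \<ge> 1" "0 \<le> q" "q \<le> 1" "s \<ge> 1"
    and W: "\<And>x. x \<in> X \<Longrightarrow> W x \<subseteq> V \<and> card (W x) = s"
    and overlap: "\<And>l. l \<in> {1..s} \<Longrightarrow>
      real (card {(x, y). x \<in> X \<and> y \<in> X \<and> card (W x \<inter> W y) = l})
        \<le> (real N * (q / real N) ^ l) * (real (card X))\<^sup>2"
  shows "measure_pmf.expectation (colouring_pmf V q N) (\<lambda>c. (real (card {x\<in>X. monochrome N c (W x)}))\<^sup>2)
       \<le> (1 + real s) * (real (card X) * (real N * (q / real N) ^ s))\<^sup>2"
proof -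
  define \<rho> where "\<rho> = q / real N"
  define \<mu> where "\<mu> = real N * \<rho> ^ s"
  have "\<rho> \<ge> 0" unfolding \<rho>_def using assms by simp
  let ?P = "colouring_pmf V q N"
  let ?t = "\<lambda>(x, y). card (W x \<inter> W y)"
  \<comment> \<open>Overlapping sets must agree on one of the \<open>N\<close> colours, and
    \<open>2 * s - l\<close> is the size of their union. Disjoint sets have a free choice of two
    colours, so \<open>l = 0\<close> carries \<open>N\<^sup>2\<close> instead of
    \<open>N\<close>.\<close>
  define b where "b l = (if l = 0 then \<mu>\<^sup>2 else real N * \<rho> ^ (2 * s - l))" for l
  have finW: "finite (W x)" if "x \<in> X" for x
    using W that \<open>finite V\<close> finite_subset by blast
  have pair: "measure_pmf.prob ?P {c. monochrome N c (W x) \<and> monochrome N c (W y)} \<le> b (card (W x \<inter> W y))"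
    if "x \<in> X" "y \<in> X" for x y
  proof (cases "W x \<inter> W y = {}")
    case True
    have "measure_pmf.prob ?P {c. monochrome N c (W x) \<and> monochrome N c (W y)} \<le> \<mu> * \<mu>"
      using prob_monochrome_disjoint[of V "W x" "W y" q N] True W that assms by (simp add: \<mu>_def \<rho>_def)
    then show ?thesis using True by (simp add: b_def power2_eq_square)
  next
    case False
    have "card (W x \<union> W y) = 2 * s - card (W x \<inter> W y)"
      using card_Un_Int[of "W x" "W y"] finW W that by simp
    moreover have "measure_pmf.prob ?P {c. monochrome N c (W x) \<and> monochrome N c (W y)}
        \<le> measure_pmf.prob ?P {c. monochrome N c (W x \<union> W y)}"
      using monochrome_Un[OF _ _ False] by (intro measure_pmf.finite_measure_mono) auto
    moreover have "measure_pmf.prob ?P {c. monochrome N c (W x \<union> W y)} = real N * \<rho> ^ card (W x \<union> W y)"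
      unfolding \<rho>_def using W that False assms by (intro prob_monochrome) auto
    ultimately show ?thesis using False finW that by (simp add: b_def)
  qed
  have sq: "(real (card {x\<in>X. monochrome N c (W x)}))\<^sup>2
      = real (card {p\<in>X \<times> X. monochrome N c (W (fst p)) \<and> monochrome N c (W (snd p))})" for c
  proof -
    have "{p\<in>X \<times> X. monochrome N c (W (fst p)) \<and> monochrome N c (W (snd p))}
        = {x\<in>X. monochrome N c (W x)} \<times> {x\<in>X. monochrome N c (W x)}" by auto
    then show ?thesis by (simp add: card_cartesian_product power2_eq_square)
  qed
  have t_le: "?t ` (X \<times> X) \<subseteq> {0..s}"
  proof clarify
    fix x y assume xy: "x \<in> X" "y \<in> X"
    have "card (W x \<inter> W y) \<le> card (W x)" using xy finW by (intro card_mono) auto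
    then show "card (W x \<inter> W y) \<in> {0..s}" using W xy by simp
  qed
  have "measure_pmf.expectation ?P (\<lambda>c. (real (card {x\<in>X. monochrome N c (W x)}))\<^sup>2)
      = (\<Sum>p\<in>X \<times> X. measure_pmf.prob ?P {c. monochrome N c (W (fst p)) \<and> monochrome N c (W (snd p))})"
    unfolding sq using assms by (intro expectation_card_filter finite_set_colouring_pmf) auto
  also have "\<dots> \<le> (\<Sum>p\<in>X \<times> X. b (?t p))"
    using pair by (intro sum_mono) auto
  also have "\<dots> = (\<Sum>l\<in>{0..s}. \<Sum>p\<in>{p\<in>X \<times> X. ?t p = l}. b (?t p))"
    using \<open>finite X\<close> t_le by (intro sum.group[symmetric]) auto
  also have "\<dots> = (\<Sum>l\<in>{0..s}. real (card {(x, y). x \<in> X \<and> y \<in> X \<and> card (W x \<inter> W y) = l}) * b l)"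
  proof (intro sum.cong refl)
    fix l
    have "(\<Sum>p\<in>{p\<in>X \<times> X. ?t p = l}. b (?t p)) = (\<Sum>p\<in>{p\<in>X \<times> X. ?t p = l}. b l)"
      by (intro sum.cong) auto
    moreover have "{p\<in>X \<times> X. ?t p = l} = {(x, y). x \<in> X \<and> y \<in> X \<and> card (W x \<inter> W y) = l}"
      by auto
    ultimately show "(\<Sum>p\<in>{p\<in>X \<times> X. ?t p = l}. b (?t p))
        = real (card {(x, y). x \<in> X \<and> y \<in> X \<and> card (W x \<inter> W y) = l}) * b l"
      by simp
  qed
  also have "\<dots> \<le> (\<Sum>l\<in>{0..s}. (real (card X) * \<mu>)\<^sup>2)"
  proof (intro sum_mono)
    fix l assume l: "l \<in> {0..s}"
    show "real (card {(x, y). x \<in> X \<and> y \<in> X \<and> card (W x \<inter> W y) = l}) * b l \<le> (real (card X) * \<mu>)\<^sup>2"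
    proof (cases "l = 0")
      case True
      have "card {(x, y). x \<in> X \<and> y \<in> X \<and> card (W x \<inter> W y) = l} \<le> card (X \<times> X)"
        using \<open>finite X\<close> by (intro card_mono) auto
      then have "real (card {(x, y). x \<in> X \<and> y \<in> X \<and> card (W x \<inter> W y) = l}) \<le> (real (card X))\<^sup>2"
        unfolding card_cartesian_product power2_eq_square of_nat_mult[symmetric] by (rule of_nat_mono)
      then show ?thesis
        using True by (simp add: b_def power_mult_distrib mult_right_mono)
    next
      case False
      have "real (card {(x, y). x \<in> X \<and> y \<in> X \<and> card (W x \<inter> W y) = l}) * b l
          \<le> ((real N * \<rho> ^ l) * (real (card X))\<^sup>2) * (real N * \<rho> ^ (2 * s - l))"
        using overlap[of l] False l \<open>\<rho> \<ge> 0\<close> by (simp add: b_def \<rho>_def mult_right_mono)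
      also have "\<dots> = (real (card X))\<^sup>2 * (real N)\<^sup>2 * (\<rho> ^ l * \<rho> ^ (2 * s - l))"
        by (simp add: power2_eq_square)
      \<comment> \<open>The dependence on \<open>l\<close> cancels here; \<open>l \<le> s\<close>
        keeps the subtraction of naturals from truncating.\<close>
      also have "\<rho> ^ l * \<rho> ^ (2 * s - l) = (\<rho> ^ s)\<^sup>2"
        using l by (simp flip: power_add power_mult add: mult.commute)
      finally show ?thesis by (simp add: \<mu>_def power_mult_distrib mult.assoc)
    qed
  qed
  finally show ?thesis by (simp add: \<mu>_def \<rho>_def algebra_simps)
qed

section \<open>Copies of a graph and their dependence on the edge set\<close>

lemma copies_vertices:
  assumes "H \<in> copies A G"
  shows "vertices H \<subseteq> vertices G" and "card (vertices H) = card (vertices A)"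
  using assms bij_betw_same_card[of _ "vertices A" "vertices H"]
  by (auto simp: copies_def subgraph_of_def graph_iso_def)

lemma finite_copies:
  assumes "simple_graph G"
  shows "finite (copies A G)"
proof (rule finite_subset)
  show "copies A G \<subseteq> Pow (vertices G) \<times> Pow (edges G)"
    by (auto simp: copies_def subgraph_of_def)
  show "finite (Pow (vertices G) \<times> Pow (edges G))"
    using assms finite_subset[OF _ finite_imp_finite_nsets, of "edges G" "vertices G" 2]
    unfolding simple_graph_def by blast
qed

text \<open>A set of at most one vertex contains no pair, so the copies depend on the vertex set
  alone and can be counted without samples.\<close>

lemma copies_no_edges:
  assumes "card (vertices A) \<le> 1"
  shows "copies A G = copies A (vertices G, {})"
proof -
  have "edges H = {}" if "simple_graph H" "card (vertices H) = card (vertices A)" for H :: "'b ugraph"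
  proof -
    have "[vertices H]\<^bsup>2\<^esup> = {}"
      using that assms by (intro nsets_eq_empty) (auto simp: simple_graph_def)
    then show ?thesis using that by (auto simp: simple_graph_def)
  qed
  then have "edges H = {}" if "H \<in> copies A G" for H
    using that copies_vertices(2)[OF that] by (simp add: copies_def subgraph_of_def)
  then show ?thesis by (auto simp: copies_def subgraph_of_def)
qed

text \<open>Every edge of a monochromatic copy is a monochromatic pair, hence sampled.
  \<open>S\<close> is only required to contain these pairs because the sample pools the pairs of
  many colourings.\<close>

lemma copies_restrict_monochrome:
  assumes "vertices G = V" and S: "{e\<in>[V]\<^bsup>2\<^esup>. monochrome N c e} \<subseteq> S"
  shows "{H\<in>copies A (V, edges G \<inter> S). monochrome N c (vertices H)}
       = {H\<in>copies A G. monochrome N c (vertices H)}"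
proof -
  have "edges H \<subseteq> S" if "simple_graph H" "vertices H \<subseteq> V" "monochrome N c (vertices H)" for H
  proof
    fix e assume "e \<in> edges H"
    then have "e \<in> [vertices H]\<^bsup>2\<^esup>" using that by (auto simp: simple_graph_def)
    then have "e \<in> [V]\<^bsup>2\<^esup>" "e \<subseteq> vertices H" using that by (auto simp: nsets_def)
    then show "e \<in> S" using S that monochrome_subset by blast
  qed
  then show ?thesis using assms by (auto simp: copies_def subgraph_of_def)
qed

section \<open>Choice of the sampling rates\<close>

definition overlap_term :: "(nat \<Rightarrow> real) \<Rightarrow> nat \<Rightarrow> real" where
  "overlap_term f l = rpow (f l) (2 / real l)
     + rpow (f l) (1 / (real l - 1)) * rpow (f 1) (1 - 1 / (real l - 1))"

lemma rpow_nonneg: "rpow x a \<ge> 0"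
  by (simp add: rpow_def)

lemma overlap_term_nonneg: "overlap_term f l \<ge> 0"
  by (simp add: overlap_term_def rpow_nonneg)

lemma rpow_scale_le:
  assumes "0 \<le> x" "x \<le> c * y" "c > 0" "y \<ge> 0" "a \<ge> 0"
  shows "rpow x a \<le> c powr a * rpow y a"
  using assms powr_mono2[of a x "c * y"] by (auto simp: rpow_def powr_mult)

text \<open>The first part of the term is homogeneous of degree \<open>2 / l \<le> 1\<close> and the
  second of degree \<open>a + (1 - a) = 1\<close>, so overestimating the fractions by a factor
  \<open>c \<ge> 1\<close> costs at most that factor.\<close>

lemma overlap_term_scale_le:
  assumes "l \<ge> 2" "c \<ge> 1" "0 \<le> F l" "0 \<le> F 1" "0 \<le> f l" "0 \<le> f 1" "F l \<le> c * f l" "F 1 \<le> c * f 1"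
  shows "overlap_term F l \<le> c * overlap_term f l"
proof -
  define a where "a = 1 / (real l - 1)"
  have a: "0 \<le> a" "a \<le> 1" using \<open>l \<ge> 2\<close> by (auto simp: a_def)
  have "rpow (F l) (2 / real l) \<le> c powr (2 / real l) * rpow (f l) (2 / real l)"
    using assms by (intro rpow_scale_le) auto
  also have "\<dots> \<le> c * rpow (f l) (2 / real l)"
    using assms powr_mono[of "2 / real l" 1 c] by (intro mult_right_mono rpow_nonneg) auto
  finally have 1: "rpow (F l) (2 / real l) \<le> c * rpow (f l) (2 / real l)" .
  have "rpow (F l) a * rpow (F 1) (1 - a)
      \<le> (c powr a * rpow (f l) a) * (c powr (1 - a) * rpow (f 1) (1 - a))"
    using assms a by (intro mult_mono rpow_scale_le mult_nonneg_nonneg rpow_nonneg) auto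
  also have "\<dots> = c * (rpow (f l) a * rpow (f 1) (1 - a))"
    using \<open>c \<ge> 1\<close> by (simp add: powr_diff)
  finally show ?thesis using 1 by (simp add: overlap_term_def a_def distrib_left)
qed

lemma powr_inverse_nat_power:
  assumes "x \<ge> 0" "k > 0"
  shows "(x powr (1 / real k)) ^ k = x"
  using assms by (cases "x = 0") (simp_all flip: powr_realpow add: powr_powr)

text \<open>With \<open>q = F\<^sub>1\<close> the constraint at \<open>l = 1\<close> is tight, and the others dictate \<open>1 / N\<close>, which yields
  the second kind of terms. If that would require \<open>1 / N > 1\<close>, then one colour suffices and the constraints
  at \<open>l \<ge> 2\<close> dictate \<open>q\<close>, which yields the first kind.\<close>

lemma sampling_rates:
  fixes F :: "nat \<Rightarrow> real"
  assumes "s \<ge> 2" and F: "\<And>l. l \<in> {1..s} \<Longrightarrow> 0 \<le> F l \<and> F l \<le> 1" and "F s > 0"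
  obtains q :: real and N :: nat where "0 < q" "q \<le> 1" "N \<ge> 1"
    and "\<And>l. l \<in> {1..s} \<Longrightarrow> F l \<le> real N * (q / real N) ^ l"
    and "real N * (q / real N)\<^sup>2 \<le> 2 * (\<Sum>l=2..s. overlap_term F l)"
proof -
  have term_le: "overlap_term F j \<le> (\<Sum>l=2..s. overlap_term F l)" if "j \<in> {2..s}" for j
    using that by (intro member_le_sum overlap_term_nonneg) auto
  show thesis
  proof (cases "\<forall>l\<in>{2..s}. F l \<le> F 1 ^ l")
    case True
    then have "F 1 ^ s > 0" using assms by force
    then have F1: "F 1 > 0"
      using F[of 1] \<open>s \<ge> 2\<close> by (cases "F 1 = 0") (auto simp: power_0_left)
    \<comment> \<open>With \<open>q = F 1\<close> the constraint at \<open>l\<close> reads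
      \<open>F l \<le> F 1 ^ l * (1 / N) ^ (l - 1)\<close>, so \<open>h l\<close> is the least value
      of \<open>1 / N\<close> that satisfies it.\<close>
    define h where "h l = (F l / F 1 ^ l) powr (1 / real (l - 1))" for l
    define p where "p = Max (h ` {2..s})"
    have "p \<in> h ` {2..s}" unfolding p_def using \<open>s \<ge> 2\<close> by (intro Max_in) auto
    then obtain j where j: "j \<in> {2..s}" "p = h j" by auto
    have h_le: "h l \<le> p" if "l \<in> {2..s}" for l
      unfolding p_def using that by (intro Max_ge) auto
    have "h s > 0" using \<open>F s > 0\<close> F1 by (simp add: h_def)
    then have "p > 0" using h_le[of s] \<open>s \<ge> 2\<close> by simp
    have "p \<le> 1"
      using j True F[of j] F1 by (auto simp: h_def intro!: powr_le1)
    \<comment> \<open>Rounding down keeps \<open>1 / N \<ge> p\<close>, so all constraints survive.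
      As \<open>1 / p \<ge> 1\<close>, it loses at most a factor 2, the source of the 2 in the rate
      bound.\<close>
    define N where "N = nat \<lfloor>1 / p\<rfloor>"
    have "1 \<le> 1 / p" using \<open>p > 0\<close> \<open>p \<le> 1\<close> by simp
    then have "N \<ge> 1" "real N \<le> 1 / p" "1 / p < real N + 1"
      unfolding N_def by linarith+
    then have "1 / p \<le> 2 * real N" by linarith
    then have N: "N \<ge> 1" "p \<le> 1 / real N" "1 / real N \<le> 2 * p"
      using \<open>N \<ge> 1\<close> \<open>real N \<le> 1 / p\<close> \<open>p > 0\<close> by (auto simp: field_simps)
    have rate_eq: "real N * (F 1 / real N) ^ l = F 1 ^ l * (1 / real N) ^ (l - 1)" if "l \<ge> 1" for l
      using that N(1) by (cases l) (auto simp: power_divide field_simps)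
    have cover: "F l \<le> real N * (F 1 / real N) ^ l" if l: "l \<in> {1..s}" for l
    proof (cases "l = 1")
      case True
      then show ?thesis using N by simp
    next
      case False
      then have l2: "l \<in> {2..s}" using l by auto
      have "h l ^ (l - 1) = F l / F 1 ^ l"
        unfolding h_def using F1 F[of l] l l2 by (intro powr_inverse_nat_power) auto
      then have "F l = F 1 ^ l * h l ^ (l - 1)"
        using F1 by simp
      also have "\<dots> \<le> F 1 ^ l * (1 / real N) ^ (l - 1)"
        using F1 h_le[OF l2] N by (intro mult_left_mono power_mono) (auto simp: h_def)
      finally show ?thesis using rate_eq[of l] l by simp
    qed
    \<comment> \<open>The maximising index \<open>j\<close> gives a term of the second kind: with
      \<open>a = 1 / (j - 1)\<close> one has \<open>j * a = 1 + a\<close>, leaving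
      \<open>F 1\<close> with exponent \<open>2 - (1 + a) = 1 - a\<close>. For \<open>j = 2\<close>
      this exponent is 0, where \<open>F 1 > 0\<close> makes \<open>powr\<close> agree with
      \<open>rpow\<close>.\<close>
    have "(F 1)\<^sup>2 * p = rpow (F j) (1 / (real j - 1)) * rpow (F 1) (1 - 1 / (real j - 1))"
    proof -
      define a where "a = 1 / (real j - 1)"
      have ja: "real j * a = 1 + a" using j by (auto simp: a_def field_simps)
      have "a \<noteq> 0" using j by (auto simp: a_def)
      have "p = F j powr a / F 1 powr (real j * a)"
        using j F1 F[of j] by (simp add: h_def a_def powr_divide powr_powr of_nat_diff flip: powr_realpow)
      then have "(F 1)\<^sup>2 * p = F j powr a * (F 1 powr 2 / F 1 powr (1 + a))"
        using F1 by (simp add: ja powr_numeral)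
      also have "F 1 powr 2 / F 1 powr (1 + a) = F 1 powr (1 - a)"
        unfolding powr_diff[symmetric] by simp
      finally have "(F 1)\<^sup>2 * p = F j powr a * F 1 powr (1 - a)" .
      then show ?thesis using \<open>a \<noteq> 0\<close> F1 by (simp add: rpow_def flip: a_def)
    qed
    also have "\<dots> \<le> overlap_term F j" by (simp add: overlap_term_def rpow_nonneg)
    also have "\<dots> \<le> (\<Sum>l=2..s. overlap_term F l)" using term_le j by simp
    finally have "(F 1)\<^sup>2 * p \<le> (\<Sum>l=2..s. overlap_term F l)" .
    moreover have "real N * (F 1 / real N)\<^sup>2 \<le> (F 1)\<^sup>2 * (2 * p)"
      using rate_eq[of 2] mult_left_mono[OF N(3), of "(F 1)\<^sup>2"] by simp
    ultimately have "real N * (F 1 / real N)\<^sup>2 \<le> 2 * (\<Sum>l=2..s. overlap_term F l)" by simp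
    then show thesis using that[of "F 1" N] F1 F[of 1] N cover \<open>s \<ge> 2\<close> by simp
  next
    case False
    then obtain i where i: "i \<in> {2..s}" "F 1 ^ i < F i" by force
    \<comment> \<open>With \<open>N = 1\<close> the constraint at \<open>l\<close> reads
      \<open>F l \<le> q ^ l\<close>, so \<open>g l\<close> is the least admissible
      \<open>q\<close>.\<close>
    define g where "g l = F l powr (1 / real l)" for l
    define q where "q = Max (g ` {2..s})"
    have "q \<in> g ` {2..s}" unfolding q_def using \<open>s \<ge> 2\<close> by (intro Max_in) auto
    then obtain j where j: "j \<in> {2..s}" "q = g j" by auto
    have g_le: "g l \<le> q" if "l \<in> {2..s}" for l
      unfolding q_def using that by (intro Max_ge) auto
    have g_pow: "g l ^ l = F l" if "l \<in> {1..s}" for l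
      using F[OF that] that by (simp add: g_def powr_inverse_nat_power)
    have "g s > 0" using \<open>F s > 0\<close> by (simp add: g_def)
    then have "q > 0" using g_le[of s] \<open>s \<ge> 2\<close> by simp
    have "q \<le> 1" using j F[of j] by (auto simp: g_def intro!: powr_le1)
    \<comment> \<open>The index \<open>i\<close> that violates the case assumption forces
      \<open>F 1 < g i \<le> q\<close>, which settles the constraint at \<open>l = 1\<close>, an
      index outside the maximum.\<close>
    have "F 1 ^ i < g i ^ i" using i g_pow by simp
    then have "F 1 < g i" by (rule power_less_imp_less_base) (simp add: g_def)
    then have "F 1 \<le> q" using g_le i by fastforce
    have cover: "F l \<le> q ^ l" if l: "l \<in> {1..s}" for l
    proof (cases "l = 1")
      case True
      then show ?thesis using \<open>F 1 \<le> q\<close> by simp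
    next
      case False
      have "g l ^ l \<le> q ^ l" using g_le[of l] False l by (intro power_mono) (auto simp: g_def)
      then show ?thesis using g_pow l by simp
    qed
    have "q\<^sup>2 = rpow (F j) (2 / real j)"
    proof -
      have "F j > 0" using \<open>q > 0\<close> j F[of j] by (cases "F j = 0") (auto simp: g_def)
      then have "q\<^sup>2 = q powr 2" using \<open>q > 0\<close> by (simp add: powr_numeral)
      also have "\<dots> = F j powr (2 / real j)" using j by (simp add: g_def powr_powr)
      finally show ?thesis using j by (simp add: rpow_def)
    qed
    also have "\<dots> \<le> overlap_term F j" by (simp add: overlap_term_def rpow_nonneg)
    also have "\<dots> \<le> (\<Sum>l=2..s. overlap_term F l)" using term_le j by simp
    also have "\<dots> \<le> 2 * (\<Sum>l=2..s. overlap_term F l)"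
      by (simp add: sum_nonneg overlap_term_nonneg)
    finally show thesis using that[of q 1] \<open>q > 0\<close> \<open>q \<le> 1\<close> cover by simp
  qed
qed

section \<open>Median of means\<close>

lemma majorities_intersect:
  assumes "finite I" "card I < 2 * card {i\<in>I. P i}" "card I < 2 * card {i\<in>I. Q i}"
  shows "\<exists>i\<in>I. P i \<and> Q i"
proof (rule ccontr)
  assume "\<not> ?thesis"
  then have "{i\<in>I. P i} \<inter> {i\<in>I. Q i} = {}" by auto
  then have "card {i\<in>I. P i} + card {i\<in>I. Q i} = card ({i\<in>I. P i} \<union> {i\<in>I. Q i})"
    using \<open>finite I\<close> by (simp add: card_Un_disjoint)
  also have "\<dots> \<le> card I"
    using \<open>finite I\<close> by (intro card_mono) auto
  finally show False using assms by simp
qed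

text \<open>Both values are compared through the common \<open>x\<close>, so the factor is
  squared.\<close>

lemma within_factor_common:
  assumes "c > 0" "within_factor c x y" "within_factor c x z"
  shows "within_factor (c\<^sup>2) y z"
proof -
  have "z / c \<le> c * y" "y / c \<le> c * z"
    using assms by (auto simp: within_factor_def)
  then show ?thesis
    using \<open>c > 0\<close> by (auto simp: within_factor_def field_simps power2_eq_square)
qed

text \<open>The lower side needs its own hypothesis: \<open>1 / (1 + \<epsilon>)\<close> exceeds
  \<open>1 - \<epsilon>\<close> for positive \<epsilon>, so an additive error of
  \<open>\<epsilon> * y\<close> would be too large below.\<close>

lemma within_factor_of_abs_diff:
  assumes "\<bar>x - y\<bar> \<le> \<eta> * y" "y \<ge> 0" "\<eta> \<le> \<epsilon>" "1 / (1 + \<epsilon>) \<le> 1 - \<eta>"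
  shows "within_factor (1 + \<epsilon>) x y"
proof -
  have "y / (1 + \<epsilon>) \<le> (1 - \<eta>) * y"
    using mult_right_mono[OF assms(4) \<open>y \<ge> 0\<close>] by simp
  moreover have "\<eta> * y \<le> \<epsilon> * y" using assms by (intro mult_right_mono)
  ultimately show ?thesis
    using assms(1) by (auto simp: within_factor_def algebra_simps)
qed

section \<open>The estimator obtained from a single colouring\<close>

definition mono_pairs :: "'v set \<Rightarrow> nat \<Rightarrow> ('v \<Rightarrow> nat) \<Rightarrow> 'v set set" where
  "mono_pairs V N c = {e\<in>[V]\<^bsup>2\<^esup>. monochrome N c e}"

text \<open>The denominator is the probability that a given copy is monochromatic, which makes the
  estimate unbiased. The edge set is a separate argument so that the received sample can be inserted
  for it.\<close>

definition copies_estimate ::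
    "'a ugraph \<Rightarrow> 'v set \<Rightarrow> real \<Rightarrow> nat \<Rightarrow> 'v set set \<Rightarrow> ('v \<Rightarrow> nat) \<Rightarrow> real" where
  "copies_estimate A V q N E c =
     real (card {H\<in>copies A (V, E). monochrome N c (vertices H)})
       / (real N * (q / real N) ^ card (vertices A))"

lemma copies_estimate_restrict:
  assumes "vertices G = V" "mono_pairs V N c \<subseteq> S"
  shows "copies_estimate A V q N (edges G \<inter> S) c = copies_estimate A V q N (edges G) c"
proof -
  have "(V, edges G) = G" using assms by (simp add: prod_eq_iff)
  then show ?thesis
    using copies_restrict_monochrome[OF assms(1) assms(2)[unfolded mono_pairs_def], of A]
    by (simp add: copies_estimate_def)
qed

lemma copies_estimate_moments:
  fixes G :: "'v ugraph"
  assumes "simple_graph G" "vertices G = V" "num_copies A G \<ge> 1" "N \<ge> 1" "0 < q" "q \<le> 1"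
    and "card (vertices A) = s" "s \<ge> 1"
    and overlap: "\<And>l. l \<in> {1..s} \<Longrightarrow> overlap_frac A G l \<le> real N * (q / real N) ^ l"
  shows "measure_pmf.expectation (colouring_pmf V q N) (copies_estimate A V q N (edges G))
           = real (num_copies A G)"
    and "measure_pmf.expectation (colouring_pmf V q N) (\<lambda>c. (copies_estimate A V q N (edges G) c)\<^sup>2)
           \<le> (1 + real s) * (real (num_copies A G))\<^sup>2"
proof -
  define \<mu> where "\<mu> = real N * (q / real N) ^ s"
  have "\<mu> > 0" using assms by (simp add: \<mu>_def)
  have G: "(V, edges G) = G" using assms by (simp add: prod_eq_iff)
  have est: "copies_estimate A V q N (edges G)
      = (\<lambda>c. real (card {H\<in>copies A G. monochrome N c (vertices H)}) / \<mu>)"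
    using assms by (simp add: copies_estimate_def G \<mu>_def fun_eq_iff)
  have finV: "finite V" using assms by (auto simp: simple_graph_def)
  have vert: "vertices H \<subseteq> V \<and> card (vertices H) = s" if "H \<in> copies A G" for H
    using copies_vertices[OF that] assms by auto
  show "measure_pmf.expectation (colouring_pmf V q N) (copies_estimate A V q N (edges G))
      = real (num_copies A G)"
    using expectation_card_monochrome[of V "copies A G" N q s vertices] vert finV assms \<open>\<mu> > 0\<close>
    by (simp add: est finite_copies num_copies_def \<mu>_def)
  have "real (card {(H, H'). H \<in> copies A G \<and> H' \<in> copies A G \<and> card (vertices H \<inter> vertices H') = l})
      \<le> (real N * (q / real N) ^ l) * (real (card (copies A G)))\<^sup>2" if "l \<in> {1..s}" for l
    using overlap[OF that] \<open>num_copies A G \<ge> 1\<close>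
    by (simp add: overlap_frac_def num_copies_def divide_le_eq)
  then have "measure_pmf.expectation (colouring_pmf V q N)
        (\<lambda>c. (real (card {H\<in>copies A G. monochrome N c (vertices H)}))\<^sup>2)
      \<le> (1 + real s) * (real (card (copies A G)) * \<mu>)\<^sup>2"
    unfolding \<mu>_def using assms finV vert
    by (intro second_moment_card_monochrome) (auto simp: finite_copies)
  then show "measure_pmf.expectation (colouring_pmf V q N) (\<lambda>c. (copies_estimate A V q N (edges G) c)\<^sup>2)
      \<le> (1 + real s) * (real (num_copies A G))\<^sup>2"
    using \<open>\<mu> > 0\<close> by (simp add: est power_divide num_copies_def divide_le_eq power_mult_distrib mult.assoc)
qed

text \<open>An edge is a vertex set of size 2, so the first-moment computation for copies applies
  with \<open>s = 2\<close>.\<close>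

lemma expectation_card_mono_pairs:
  assumes "simple_graph G" "vertices G = V" "N \<ge> 1" "0 \<le> q" "q \<le> 1"
  shows "measure_pmf.expectation (colouring_pmf V q N) (\<lambda>c. real (card (edges G \<inter> mono_pairs V N c)))
       = real (card (edges G)) * (real N * (q / real N)\<^sup>2)"
proof -
  have E: "edges G \<subseteq> [V]\<^bsup>2\<^esup>" and "finite V" using assms by (auto simp: simple_graph_def)
  then have "finite (edges G)" using finite_imp_finite_nsets finite_subset by metis
  have "edges G \<inter> mono_pairs V N c = {e\<in>edges G. monochrome N c e}" for c
    using E by (auto simp: mono_pairs_def)
  moreover have "e \<subseteq> V \<and> card e = 2" if "e \<in> edges G" for e
    using E that by (auto simp: nsets_def)
  ultimately show ?thesis
    using expectation_card_monochrome[of V "edges G" N q 2 "\<lambda>e. e"] assms \<open>finite V\<close> \<open>finite (edges G)\<close>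
    by simp
qed

section \<open>Combination of the estimates into one sampler\<close>

definition sample_mean :: "nat \<Rightarrow> ('b \<Rightarrow> real) \<Rightarrow> (nat \<Rightarrow> 'b) \<Rightarrow> real" where
  "sample_mean n Z \<omega> = (\<Sum>j<n. Z (\<omega> j)) / real n"

text \<open>A value close to more than half of the sample means plays the role of their median.\<close>

definition majority_value :: "nat \<Rightarrow> real \<Rightarrow> (nat \<Rightarrow> real) \<Rightarrow> real" where
  "majority_value r a Y = (SOME y. r < 2 * card {i\<in>{..<r}. within_factor a (Y i) y})"

text \<open>The true value \<open>y\<close> shows that the choice in \<open>majority_value\<close>
  has a witness. The majorities supporting the chosen value and \<open>y\<close> share an index, and
  the common sample mean links the two at the price of squaring the factor.\<close>

lemma within_factor_majority_value:
  assumes "a > 0" and maj: "r < 2 * card {i\<in>{..<r}. within_factor a (Y i) y}"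
  shows "within_factor (a\<^sup>2) (majority_value r a Y) y"
proof -
  have "r < 2 * card {i\<in>{..<r}. within_factor a (Y i) (majority_value r a Y)}"
    unfolding majority_value_def using maj by (rule someI)
  then have "\<exists>i\<in>{..<r}. within_factor a (Y i) (majority_value r a Y) \<and> within_factor a (Y i) y"
    using maj by (intro majorities_intersect) auto
  then show ?thesis using within_factor_common[OF \<open>a > 0\<close>] by blast
qed

text \<open>There are \<open>r\<close> batches of \<open>n\<close> colourings. The lower bound on
  \<open>n\<close> makes a batch bad with probability at most \<open>1 / 16\<close>, so half of the
  batches are bad with probability at most \<open>(1 / 2) ^ r\<close>. The cost follows from a union
  bound over all \<open>r * n\<close> colourings. The sampler is fixed before \<open>G\<close>, as
  nonadaptivity demands.\<close>

lemma median_of_means_sampler: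
  fixes A :: "'a ugraph" and V :: "'v set"
  assumes "finite V" "card (vertices A) = s" "s \<ge> 1" "N \<ge> 1" "0 < q" "q \<le> 1"
    and "0 < \<epsilon>" "0 < \<eta>" "\<eta> \<le> \<epsilon>" "1 / (1 + \<epsilon>) \<le> 1 - \<eta>" "n > 0" "16 * real s \<le> real n * \<eta>\<^sup>2"
  obtains D :: "'v sampler" where "sampling_algorithm V D" "finite (set_pmf D)"
    and "\<And>G :: 'v ugraph. \<lbrakk>simple_graph G; vertices G = V; num_copies A G \<ge> 1;
        \<forall>l\<in>{1..s}. overlap_frac A G l \<le> real N * (q / real N) ^ l\<rbrakk> \<Longrightarrow>
      measure_pmf.prob (sampler_output D G) {X. within_factor ((1 + \<epsilon>)\<^sup>2) X (real (num_copies A G))}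
        \<ge> 1 - (1 / 2) ^ r
      \<and> expected_samples D G \<le> real r * real n * (real (card (edges G)) * (real N * (q / real N)\<^sup>2))"
proof
  define P where "P = colouring_pmf V q N"
  define Q where "Q = Pi_pmf {..<n} (\<lambda>_. 0) (\<lambda>_. P)"
  define R where "R = Pi_pmf {..<r} (\<lambda>_ _. 0) (\<lambda>_. Q)"
  \<comment> \<open>One set of pairs serves all repetitions; the colourings themselves reach the
    estimator through the post-processing function \<open>g \<omega>\<close>.\<close>
  define U where "U \<omega> = (\<Union>i<r. \<Union>j<n. mono_pairs V N (\<omega> i j))" for \<omega> :: "nat \<Rightarrow> nat \<Rightarrow> 'v \<Rightarrow> nat"
  define g where "g \<omega> E =
      majority_value r (1 + \<epsilon>) (\<lambda>i. sample_mean n (copies_estimate A V q N E) (\<omega> i))"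
    for \<omega> :: "nat \<Rightarrow> nat \<Rightarrow> 'v \<Rightarrow> nat" and E
  define D where "D = map_pmf (\<lambda>\<omega>. (U \<omega>, g \<omega>)) R"
  have finP: "finite (set_pmf P)"
    unfolding P_def using assms by (intro finite_set_colouring_pmf)
  then have finQ: "finite (set_pmf Q)"
    unfolding Q_def by (intro finite_set_Pi_pmf) auto
  then have finR: "finite (set_pmf R)"
    unfolding R_def by (intro finite_set_Pi_pmf) auto
  then show "finite (set_pmf D)" by (simp add: D_def)
  show "sampling_algorithm V D"
    by (auto simp: sampling_algorithm_def D_def U_def mono_pairs_def)
  fix G :: "'v ugraph"
  assume G: "simple_graph G" "vertices G = V" "num_copies A G \<ge> 1"
    and overlap: "\<forall>l\<in>{1..s}. overlap_frac A G l \<le> real N * (q / real N) ^ l"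
  define M where "M = real (num_copies A G)"
  have "M > 0" using G by (simp add: M_def)
  define Z where "Z = copies_estimate A V q N (edges G)"
  define B where "B = {\<omega>. \<bar>(\<Sum>j<n. Z (\<omega> j)) / real n - M\<bar> \<ge> \<eta> * M}"
  have "measure_pmf.expectation P Z = M"
    and "measure_pmf.expectation P (\<lambda>c. (Z c)\<^sup>2) \<le> (1 + real s) * M\<^sup>2"
    using copies_estimate_moments[OF G \<open>N \<ge> 1\<close> \<open>0 < q\<close> \<open>q \<le> 1\<close> assms(2,3) bspec[OF overlap]]
    by (auto simp: P_def Z_def M_def)
  then have "measure_pmf.prob Q B \<le> real s / (real n * \<eta>\<^sup>2)"
    unfolding Q_def B_def using finP \<open>M > 0\<close> assms by (intro prob_sample_mean_deviation) auto
  also have "\<dots> \<le> 1 / 16"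
    using assms by (simp add: divide_le_eq)
  finally have "measure_pmf.prob Q B \<le> 1 / 16" .
  then have bad: "measure_pmf.prob R {\<omega>. r \<le> 2 * card {i\<in>{..<r}. \<omega> i \<in> B}} \<le> (1 / 2) ^ r"
    unfolding R_def using finQ by (intro prob_half_bad_le)
  have good: "within_factor ((1 + \<epsilon>)\<^sup>2) (g \<omega> (edges G \<inter> U \<omega>)) M"
    if "\<not> r \<le> 2 * card {i\<in>{..<r}. \<omega> i \<in> B}" for \<omega>
  proof -
    let ?Y = "\<lambda>i. sample_mean n (copies_estimate A V q N (edges G \<inter> U \<omega>)) (\<omega> i)"
    have Y: "?Y i = (\<Sum>j<n. Z (\<omega> i j)) / real n" if "i < r" for i
    proof -
      \<comment> \<open>Pairs contributed by the other colourings do not disturb this estimate,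
        since it counts only copies monochromatic under \<open>\<omega> i j\<close>.\<close>
      have "copies_estimate A V q N (edges G \<inter> U \<omega>) (\<omega> i j) = Z (\<omega> i j)" if "j < n" for j
        unfolding Z_def using \<open>i < r\<close> that G
        by (intro copies_estimate_restrict) (auto simp: U_def)
      then show ?thesis by (simp add: sample_mean_def)
    qed
    have sub: "{..<r} - {i\<in>{..<r}. \<omega> i \<in> B} \<subseteq> {i\<in>{..<r}. within_factor (1 + \<epsilon>) (?Y i) M}"
      using \<open>M > 0\<close> assms by (auto simp: Y B_def intro!: within_factor_of_abs_diff[where \<eta> = \<eta>])
    have "r - card {i\<in>{..<r}. \<omega> i \<in> B} = card ({..<r} - {i\<in>{..<r}. \<omega> i \<in> B})"
      by (subst card_Diff_subset) auto
    also have "\<dots> \<le> card {i\<in>{..<r}. within_factor (1 + \<epsilon>) (?Y i) M}"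
      using sub by (intro card_mono) auto
    finally have "r < 2 * card {i\<in>{..<r}. within_factor (1 + \<epsilon>) (?Y i) M}"
      using that by linarith
    then show ?thesis
      unfolding g_def using \<open>0 < \<epsilon>\<close> by (intro within_factor_majority_value) auto
  qed
  have "1 - (1 / 2) ^ r \<le> 1 - measure_pmf.prob R {\<omega>. r \<le> 2 * card {i\<in>{..<r}. \<omega> i \<in> B}}"
    using bad by simp
  also have "\<dots> = measure_pmf.prob R (UNIV - {\<omega>. r \<le> 2 * card {i\<in>{..<r}. \<omega> i \<in> B}})"
    using measure_pmf.prob_compl[of "{\<omega>. r \<le> 2 * card {i\<in>{..<r}. \<omega> i \<in> B}}" R] by simp
  also have "\<dots> \<le> measure_pmf.prob R {\<omega>. within_factor ((1 + \<epsilon>)\<^sup>2) (g \<omega> (edges G \<inter> U \<omega>)) M}"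
    using good by (intro measure_pmf.finite_measure_mono) auto
  also have "\<dots> = measure_pmf.prob (sampler_output D G) {X. within_factor ((1 + \<epsilon>)\<^sup>2) X M}"
    by (simp add: sampler_output_def D_def map_pmf_comp vimage_def)
  finally have success: "1 - (1 / 2) ^ r
      \<le> measure_pmf.prob (sampler_output D G) {X. within_factor ((1 + \<epsilon>)\<^sup>2) X M}" .

  have finE: "finite (edges G)"
    using G finite_imp_finite_nsets finite_subset unfolding simple_graph_def by metis
  have card_le: "real (card (edges G \<inter> U \<omega>))
      \<le> (\<Sum>i<r. \<Sum>j<n. real (card (edges G \<inter> mono_pairs V N (\<omega> i j))))" for \<omega>
  proof -
    have "edges G \<inter> U \<omega> = (\<Union>i<r. \<Union>j<n. edges G \<inter> mono_pairs V N (\<omega> i j))"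
      by (auto simp: U_def)
    also have "card \<dots> \<le> (\<Sum>i<r. card (\<Union>j<n. edges G \<inter> mono_pairs V N (\<omega> i j)))"
      by (rule card_UN_le) simp
    also have "\<dots> \<le> (\<Sum>i<r. \<Sum>j<n. card (edges G \<inter> mono_pairs V N (\<omega> i j)))"
      by (intro sum_mono card_UN_le) simp
    finally show ?thesis by (simp flip: of_nat_sum)
  qed
  have "expected_samples D G = measure_pmf.expectation R (\<lambda>\<omega>. real (card (edges G \<inter> U \<omega>)))"
    by (simp add: expected_samples_def D_def)
  also have "\<dots> \<le> measure_pmf.expectation R
      (\<lambda>\<omega>. \<Sum>i<r. \<Sum>j<n. real (card (edges G \<inter> mono_pairs V N (\<omega> i j))))"
    using card_le by (intro integral_mono integrable_measure_pmf_finite finR)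
  also have "\<dots> = (\<Sum>i<r. \<Sum>j<n. measure_pmf.expectation R
      (\<lambda>\<omega>. real (card (edges G \<inter> mono_pairs V N (\<omega> i j)))))"
    by (simp add: integrable_measure_pmf_finite finR)
  also have "\<dots> = (\<Sum>i<r. \<Sum>j<n. real (card (edges G)) * (real N * (q / real N)\<^sup>2))"
  proof (intro sum.cong refl)
    fix i j assume ij: "i \<in> {..<r}" "j \<in> {..<n}"
    let ?h = "\<lambda>c. real (card (edges G \<inter> mono_pairs V N c))"
    have "measure_pmf.expectation R (\<lambda>\<omega>. ?h (\<omega> i j)) = measure_pmf.expectation Q (\<lambda>\<omega>. ?h (\<omega> j))"
      unfolding R_def using ij by (intro expectation_Pi_pmf_component[where h = "\<lambda>\<omega>. ?h (\<omega> j)"]) auto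
    also have "\<dots> = measure_pmf.expectation P ?h"
      unfolding Q_def using ij by (intro expectation_Pi_pmf_component) auto
    also have "\<dots> = real (card (edges G)) * (real N * (q / real N)\<^sup>2)"
      unfolding P_def using G assms by (intro expectation_card_mono_pairs) auto
    finally show "measure_pmf.expectation R (\<lambda>\<omega>. ?h (\<omega> i j))
        = real (card (edges G)) * (real N * (q / real N)\<^sup>2)" .
  qed
  finally have "expected_samples D G \<le> real r * real n * (real (card (edges G)) * (real N * (q / real N)\<^sup>2))"
    by simp
  with success show "measure_pmf.prob (sampler_output D G)
        {X. within_factor ((1 + \<epsilon>)\<^sup>2) X (real (num_copies A G))} \<ge> 1 - (1 / 2) ^ r
      \<and> expected_samples D G \<le> real r * real n * (real (card (edges G)) * (real N * (q / real N)\<^sup>2))"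
    by (simp add: M_def)
qed

section \<open>Accuracy and failure probability\<close>

text \<open>With probability \<open>1 - p\<close> nothing is sampled and 0 is output. That branch
  costs nothing and can only add to the probability of any event.\<close>

lemma thinned_sampler:
  fixes D :: "'v sampler"
  assumes "sampling_algorithm V D" "finite (set_pmf D)" "0 \<le> p" "p \<le> 1"
  obtains D' :: "'v sampler" where "sampling_algorithm V D'"
    and "\<And>G. expected_samples D' G = p * expected_samples D G"
    and "\<And>G X. measure_pmf.prob (sampler_output D' G) X \<ge> p * measure_pmf.prob (sampler_output D G) X"
proof
  define D' where "D' = bernoulli_pmf p \<bind> (\<lambda>b. if b then D else return_pmf ({}, \<lambda>_. 0))"
  have expect: "measure_pmf.expectation D' h
      = p * measure_pmf.expectation D h + (1 - p) * h ({}, \<lambda>_. 0)"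
    for h :: "_ \<Rightarrow> real"
    unfolding D'_def using assms
    by (subst pmf_expectation_bind[of UNIV]) (auto simp: UNIV_bool)
  show "sampling_algorithm V D'"
    using assms by (auto simp: D'_def sampling_algorithm_def set_bind_pmf split: if_splits)
  show "expected_samples D' G = p * expected_samples D G" for G
    by (simp add: expected_samples_def expect)
  show "measure_pmf.prob (sampler_output D' G) X \<ge> p * measure_pmf.prob (sampler_output D G) X" for G X
  proof -
    have "measure_pmf.prob (sampler_output D'' G) X
        = measure_pmf.expectation D'' (\<lambda>(S, g). indicator X (g (edges G \<inter> S)))" for D'' :: "'v sampler"
    proof -
      have "measure_pmf.prob (sampler_output D'' G) X
          = measure_pmf.expectation (sampler_output D'' G) (indicator X)" by simp
      also have "\<dots> = measure_pmf.expectation D'' (\<lambda>(S, g). indicator X (g (edges G \<inter> S)))"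
        unfolding sampler_output_def integral_map_pmf by (simp only: split_beta')
      finally show ?thesis .
    qed
    then show ?thesis using \<open>p \<le> 1\<close> by (simp add: expect)
  qed
qed

lemma within_factor_mono:
  assumes "within_factor c x y" "0 < c" "c \<le> d" "y \<ge> 0"
  shows "within_factor d x y"
proof -
  have "y / d \<le> y / c" "c * y \<le> d * y"
    using assms by (auto intro: divide_left_mono mult_right_mono)
  then show ?thesis using assms(1) by (auto simp: within_factor_def)
qed

lemma overlap_frac_bounds:
  assumes "simple_graph G"
  shows "0 \<le> overlap_frac A G l" and "overlap_frac A G l \<le> 1"
proof -
  show "0 \<le> overlap_frac A G l" by (simp add: overlap_frac_def)
  have "card {(H, H'). H \<in> copies A G \<and> H' \<in> copies A G \<and> card (vertices H \<inter> vertices H') = l}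
      \<le> card (copies A G \<times> copies A G)"
    by (intro card_mono finite_cartesian_product finite_copies assms) auto
  then have "real (card {(H, H'). H \<in> copies A G \<and> H' \<in> copies A G \<and> card (vertices H \<inter> vertices H') = l})
      \<le> (real (num_copies A G))\<^sup>2"
    unfolding num_copies_def card_cartesian_product power2_eq_square of_nat_mult[symmetric]
    by (rule of_nat_mono)
  then show "overlap_frac A G l \<le> 1"
    by (auto simp: overlap_frac_def divide_le_eq_1)
qed

text \<open>A copy paired with itself overlaps in all its vertices. This supplies the positivity of
  \<open>F s\<close> from which \<open>sampling_rates\<close> obtains positive rates.\<close>

lemma overlap_frac_full_pos:
  assumes "simple_graph G" "num_copies A G \<ge> 1"
  shows "overlap_frac A G (card (vertices A)) > 0"
proof -
  obtain H where H: "H \<in> copies A G"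
    using assms by (metis card.empty ex_in_conv not_one_le_zero num_copies_def)
  let ?T = "{(H, H'). H \<in> copies A G \<and> H' \<in> copies A G \<and> card (vertices H \<inter> vertices H') = card (vertices A)}"
  have "(H, H) \<in> ?T" using H copies_vertices(2)[OF H] by simp
  moreover have "finite ?T"
    by (rule finite_subset[of _ "copies A G \<times> copies A G"]) (auto simp: finite_copies[OF assms(1)])
  ultimately have "card ?T > 0" unfolding card_gt_0_iff by blast
  then show ?thesis using assms(2) by (simp add: overlap_frac_def)
qed

text \<open>The factor \<open>c\<close> is kept abstract and absorbs the dependence of the cost on
  \<delta>, so that thinning can rescale cost and success probability together.\<close>

definition sampling_guarantee ::
    "'a ugraph \<Rightarrow> 'v set \<Rightarrow> real \<Rightarrow> (nat \<Rightarrow> real) \<Rightarrow> real \<Rightarrow> real \<Rightarrow> real \<Rightarrow> 'v sampler \<Rightarrow> bool" where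
  "sampling_guarantee A V K f' \<epsilon> \<delta> c D \<longleftrightarrow>
     (\<forall>G. simple_graph G \<longrightarrow> vertices G = V \<longrightarrow> num_copies A G \<ge> 1 \<longrightarrow>
        (\<forall>l\<in>{1..card (vertices A)}. within_factor K (f' l) (overlap_frac A G l)) \<longrightarrow>
        measure_pmf.prob (sampler_output D G) {X. within_factor (1 + \<epsilon>) X (real (num_copies A G))} \<ge> 1 - \<delta> \<and>
        expected_samples D G \<le> c * (real (card (edges G)) / \<epsilon>\<^sup>2 *
          (\<Sum>l=2..card (vertices A). overlap_term (overlap_frac A G) l)))"

lemma sampling_guarantee_thin:
  assumes "sampling_guarantee A V K f' \<epsilon> \<delta>\<^sub>0 c D" "sampling_algorithm V D" "finite (set_pmf D)" "0 \<le> p" "p \<le> 1"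
  obtains D' where "sampling_algorithm V D'" "sampling_guarantee A V K f' \<epsilon> (1 - p * (1 - \<delta>\<^sub>0)) (p * c) D'"
proof -
  obtain D' where D': "sampling_algorithm V D'"
    "\<And>G. expected_samples D' G = p * expected_samples D G"
    "\<And>G X. measure_pmf.prob (sampler_output D' G) X \<ge> p * measure_pmf.prob (sampler_output D G) X"
    using thinned_sampler[OF assms(2-5)] by metis
  have "p * (1 - \<delta>\<^sub>0) \<le> measure_pmf.prob (sampler_output D' G) X"
    if "1 - \<delta>\<^sub>0 \<le> measure_pmf.prob (sampler_output D G) X" for G X
    using mult_left_mono[OF that \<open>0 \<le> p\<close>] D'(3)[of G X] by linarith
  note success = this
  have "sampling_guarantee A V K f' \<epsilon> (1 - p * (1 - \<delta>\<^sub>0)) (p * c) D'"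
    unfolding sampling_guarantee_def
  proof (intro allI impI conjI)
    fix G
    assume "simple_graph G" "vertices G = V" "num_copies A G \<ge> 1"
      "\<forall>l\<in>{1..card (vertices A)}. within_factor K (f' l) (overlap_frac A G l)"
    note guarantee = assms(1)[unfolded sampling_guarantee_def, rule_format, OF this(1-3) this(4)[rule_format]]
    show "1 - (1 - p * (1 - \<delta>\<^sub>0))
        \<le> measure_pmf.prob (sampler_output D' G) {X. within_factor (1 + \<epsilon>) X (real (num_copies A G))}"
      using success guarantee by simp
    show "expected_samples D' G \<le> p * c * (real (card (edges G)) / \<epsilon>\<^sup>2 *
        (\<Sum>l=2..card (vertices A). overlap_term (overlap_frac A G) l))"
      unfolding D'(2) mult.assoc[of p c] using guarantee \<open>0 \<le> p\<close> by (intro mult_left_mono) auto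
  qed
  then show thesis using that D'(1) by blast
qed

text \<open>Rates are computed from the advice \<open>f'\<close> alone, enlarged so that they cover
  the true fractions of every consistent graph; the enlargement costs a factor
  \<open>K\<^sup>2\<close>. The bound \<open>\<delta> \<le> 1 / 2\<close> ensures that rounding up
  the number of batches costs only a constant factor.\<close>

lemma sampling_guarantee_small_delta:
  fixes A :: "'a ugraph" and V :: "'v set"
  assumes "finite V" "card (vertices A) = s" "s \<ge> 2" "K \<ge> 1" "0 < \<epsilon>" "\<epsilon> < K" "0 < \<delta>" "\<delta> \<le> 1 / 2"
    and f': "\<And>l. l \<in> {1..s} \<Longrightarrow> 0 \<le> f' l" "f' s > 0"
  obtains D :: "'v sampler" where "sampling_algorithm V D" "finite (set_pmf D)"
    and "sampling_guarantee A V K f' \<epsilon> \<delta> (32 * K\<^sup>2 * (2 + K)\<^sup>2 * (16 * real s + 1) * ln (1 / \<delta>)) D"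
proof -
  \<comment> \<open>\<open>K * f' l\<close> dominates the true fraction and exceeds it by at most a
    factor \<open>K\<^sup>2\<close>; the cap at 1 is harmless because fractions are at most
    1.\<close>
  define F where "F l = min 1 (K * f' l)" for l
  have "0 \<le> F l \<and> F l \<le> 1" if "l \<in> {1..s}" for l
    using f'(1)[OF that] \<open>K \<ge> 1\<close> by (simp add: F_def)
  moreover have "F s > 0" using f'(2) \<open>K \<ge> 1\<close> by (simp add: F_def)
  ultimately obtain q N where qN: "0 < q" "q \<le> 1" "N \<ge> 1"
    and cover: "\<And>l. l \<in> {1..s} \<Longrightarrow> F l \<le> real N * (q / real N) ^ l"
    and rate: "real N * (q / real N)\<^sup>2 \<le> 2 * (\<Sum>l=2..s. overlap_term F l)"
    using sampling_rates[OF \<open>s \<ge> 2\<close>, of F] by metis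

  \<comment> \<open>The majority vote squares the factor, and
    \<open>\<epsilon>' * (2 + \<epsilon>') \<le> \<epsilon>\<close> compensates for it;
    \<open>\<epsilon> < K\<close> yields \<open>\<epsilon>' < 1\<close>. Then
    \<open>\<eta> = \<epsilon>' / 2\<close> is small enough for
    \<open>(1 + \<epsilon>') * (1 - \<eta>) \<ge> 1\<close>.\<close>
  define \<epsilon>' where "\<epsilon>' = \<epsilon> / (2 + K)"
  define \<eta> where "\<eta> = \<epsilon>' / 2"
  have \<epsilon>': "0 < \<epsilon>'" "\<epsilon>' < 1" using assms by (auto simp: \<epsilon>'_def field_simps)
  have \<eta>: "0 < \<eta>" "\<eta> \<le> \<epsilon>'" "\<eta> < 1" using \<epsilon>' by (auto simp: \<eta>_def)
  have "\<epsilon>' * \<epsilon>' \<le> \<epsilon>' * 1" using \<epsilon>' by (intro mult_left_mono) auto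
  then have \<eta>': "1 / (1 + \<epsilon>') \<le> 1 - \<eta>"
    using \<epsilon>' by (subst pos_divide_le_eq) (auto simp: \<eta>_def algebra_simps)
  have "\<epsilon>' * (2 + \<epsilon>') \<le> \<epsilon>' * (2 + K)" using \<epsilon>' \<open>K \<ge> 1\<close> by (intro mult_left_mono) auto
  also have "\<dots> = \<epsilon>" using \<open>K \<ge> 1\<close> by (simp add: \<epsilon>'_def)
  finally have factor: "(1 + \<epsilon>')\<^sup>2 \<le> 1 + \<epsilon>" by (simp add: power2_eq_square algebra_simps)

  \<comment> \<open>Since \<open>1 \<le> 1 / \<eta>\<^sup>2\<close>, the ceiling is absorbed by
    replacing \<open>16 * s\<close> with \<open>16 * s + 1\<close>.\<close>
  define n where "n = nat \<lceil>16 * real s / \<eta>\<^sup>2\<rceil>"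
  have "16 * real s / \<eta>\<^sup>2 > 0" using \<open>s \<ge> 2\<close> \<eta> by simp
  then have n: "n > 0" "16 * real s / \<eta>\<^sup>2 \<le> real n" "real n \<le> 16 * real s / \<eta>\<^sup>2 + 1"
    unfolding n_def by linarith+
  have "1 \<le> 1 / \<eta>\<^sup>2" using \<eta> by (simp add: power_le_one)
  then have "real n \<le> (16 * real s + 1) / \<eta>\<^sup>2"
    using n(3) by (simp add: add_divide_distrib)
  also have "\<dots> = 4 * (2 + K)\<^sup>2 * (16 * real s + 1) / \<epsilon>\<^sup>2"
    unfolding \<eta>_def \<epsilon>'_def power_divide by simp
  finally have n_le: "real n \<le> 4 * (2 + K)\<^sup>2 * (16 * real s + 1) / \<epsilon>\<^sup>2" .
  have n_ge: "16 * real s \<le> real n * \<eta>\<^sup>2"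
    using n(2) \<eta> by (simp add: divide_le_eq)

  \<comment> \<open>As \<open>log 2 (1 / \<delta>) \<ge> 1\<close>, the ceiling at most doubles it,
    and \<open>ln 2 \<ge> 1 / 2\<close> costs another factor 2 in passing to
    \<open>ln\<close>.\<close>
  define r where "r = nat \<lceil>log 2 (1 / \<delta>)\<rceil>"
  have "log 2 2 \<le> log 2 (1 / \<delta>)"
    using \<open>0 < \<delta>\<close> \<open>\<delta> \<le> 1 / 2\<close> by (subst log_le_cancel_iff) (auto simp: field_simps)
  then have log_ge: "1 \<le> log 2 (1 / \<delta>)" by simp
  then have r: "log 2 (1 / \<delta>) \<le> real r" "real r \<le> log 2 (1 / \<delta>) + 1"
    unfolding r_def by linarith+
  have "1 / \<delta> = 2 powr log 2 (1 / \<delta>)" using \<open>0 < \<delta>\<close> by simp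
  also have "\<dots> \<le> 2 powr real r" using r by (intro powr_mono) auto
  also have "\<dots> = 2 ^ r" by (simp add: powr_realpow)
  finally have "(1 / 2) ^ r \<le> \<delta>" using \<open>0 < \<delta>\<close> by (simp add: power_divide field_simps)
  have "ln 2 \<ge> (1 / 2 :: real)" using ln_le_minus_one[of "1 / 2 :: real"] by (simp add: ln_div)
  have "ln (1 / \<delta>) \<ge> 0" using \<open>0 < \<delta>\<close> \<open>\<delta> \<le> 1 / 2\<close> by simp
  then have "ln (1 / \<delta>) / ln 2 \<le> ln (1 / \<delta>) / (1 / 2)"
    using \<open>ln 2 \<ge> (1 / 2 :: real)\<close> by (intro divide_left_mono) auto
  then have "log 2 (1 / \<delta>) \<le> 2 * ln (1 / \<delta>)" by (simp add: log_def)
  then have r_le: "real r \<le> 4 * ln (1 / \<delta>)" using r log_ge by linarith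

  have "s \<ge> 1" using \<open>s \<ge> 2\<close> by simp
  obtain D :: "'v sampler" where D: "sampling_algorithm V D" "finite (set_pmf D)"
    and guarantee: "\<And>G :: 'v ugraph. \<lbrakk>simple_graph G; vertices G = V; num_copies A G \<ge> 1;
        \<forall>l\<in>{1..s}. overlap_frac A G l \<le> real N * (q / real N) ^ l\<rbrakk> \<Longrightarrow>
      measure_pmf.prob (sampler_output D G) {X. within_factor ((1 + \<epsilon>')\<^sup>2) X (real (num_copies A G))}
        \<ge> 1 - (1 / 2) ^ r
      \<and> expected_samples D G \<le> real r * real n * (real (card (edges G)) * (real N * (q / real N)\<^sup>2))"
    by (rule median_of_means_sampler[where r = r, OF assms(1,2) \<open>s \<ge> 1\<close> qN(3,1,2) \<epsilon>'(1) \<eta>(1,2) \<eta>' n(1) n_ge])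
       (rule that, assumption+)
  have "sampling_guarantee A V K f' \<epsilon> \<delta> (32 * K\<^sup>2 * (2 + K)\<^sup>2 * (16 * real s + 1) * ln (1 / \<delta>)) D"
    unfolding sampling_guarantee_def \<open>card (vertices A) = s\<close>
  proof (intro allI impI)
    fix G :: "'v ugraph"
    assume G: "simple_graph G" "vertices G = V" "num_copies A G \<ge> 1"
      and wf: "\<forall>l\<in>{1..s}. within_factor K (f' l) (overlap_frac A G l)"
    let ?f = "overlap_frac A G" and ?M = "real (num_copies A G)" and ?m = "real (card (edges G))"
    let ?\<Sigma> = "\<Sum>l=2..s. overlap_term ?f l"
    have f_bounds: "0 \<le> ?f l" "?f l \<le> 1" for l
      by (rule overlap_frac_bounds[OF G(1)])+
    have F_bounds: "?f l \<le> F l \<and> F l \<le> K\<^sup>2 * ?f l" if "l \<in> {1..s}" for l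
    proof -
      have "?f l / K \<le> f' l" "f' l \<le> K * ?f l"
        using wf that by (auto simp: within_factor_def)
      then have "?f l \<le> K * f' l" "K * f' l \<le> K * (K * ?f l)"
        using \<open>K \<ge> 1\<close> by (auto simp: field_simps)
      then show ?thesis using f_bounds[of l] by (simp add: F_def power2_eq_square mult.assoc)
    qed
    have "\<forall>l\<in>{1..s}. ?f l \<le> real N * (q / real N) ^ l"
      using F_bounds cover by (meson order_trans)
    then have success: "measure_pmf.prob (sampler_output D G) {X. within_factor ((1 + \<epsilon>')\<^sup>2) X ?M}
          \<ge> 1 - (1 / 2) ^ r"
      and cost: "expected_samples D G \<le> real r * real n * (?m * (real N * (q / real N)\<^sup>2))"
      using guarantee[OF G] by blast+
    have "1 - \<delta> \<le> 1 - (1 / 2) ^ r" using \<open>(1 / 2) ^ r \<le> \<delta>\<close> by simp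
    also note success
    also have "measure_pmf.prob (sampler_output D G) {X. within_factor ((1 + \<epsilon>')\<^sup>2) X ?M}
        \<le> measure_pmf.prob (sampler_output D G) {X. within_factor (1 + \<epsilon>) X ?M}"
      using within_factor_mono[OF _ _ factor] \<epsilon>'
      by (intro measure_pmf.finite_measure_mono) auto
    finally have 1: "1 - \<delta> \<le> measure_pmf.prob (sampler_output D G) {X. within_factor (1 + \<epsilon>) X ?M}" .
    have "overlap_term F l \<le> K\<^sup>2 * overlap_term ?f l" if "l \<in> {2..s}" for l
    proof -
      have "0 \<le> F l" "0 \<le> F 1" using F_bounds[of l] F_bounds[of 1] f_bounds[of l] f_bounds[of 1] that by auto
      then show ?thesis
        using that F_bounds[of l] F_bounds[of 1] f_bounds \<open>K \<ge> 1\<close>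
        by (intro overlap_term_scale_le) auto
    qed
    then have "(\<Sum>l=2..s. overlap_term F l) \<le> (\<Sum>l=2..s. K\<^sup>2 * overlap_term ?f l)"
      by (rule sum_mono)
    then have "(\<Sum>l=2..s. overlap_term F l) \<le> K\<^sup>2 * ?\<Sigma>"
      by (simp only: sum_distrib_left)
    then have rate': "real N * (q / real N)\<^sup>2 \<le> 2 * K\<^sup>2 * ?\<Sigma>"
      using rate by linarith
    note cost
    \<comment> \<open>The constant 32 is the product of 4 from \<open>r\<close>, 4 from
      \<open>n\<close> and 2 from the sampling rate.\<close>
    also have "real r * real n * (?m * (real N * (q / real N)\<^sup>2))
        \<le> (4 * ln (1 / \<delta>)) * (4 * (2 + K)\<^sup>2 * (16 * real s + 1) / \<epsilon>\<^sup>2) * (?m * (2 * K\<^sup>2 * ?\<Sigma>))"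
      using \<open>ln (1 / \<delta>) \<ge> 0\<close> qN \<open>K \<ge> 1\<close>
      by (intro mult_mono[OF mult_mono[OF r_le n_le] mult_left_mono[OF rate']] mult_nonneg_nonneg) auto
    also have "\<dots> = 32 * K\<^sup>2 * (2 + K)\<^sup>2 * (16 * real s + 1) * ln (1 / \<delta>) * (?m / \<epsilon>\<^sup>2 * ?\<Sigma>)"
      by simp
    finally show "1 - \<delta> \<le> measure_pmf.prob (sampler_output D G) {X. within_factor (1 + \<epsilon>) X ?M} \<and>
        expected_samples D G
          \<le> 32 * K\<^sup>2 * (2 + K)\<^sup>2 * (16 * real s + 1) * ln (1 / \<delta>) * (?m / \<epsilon>\<^sup>2 * ?\<Sigma>)"
      using 1 by blast
  qed
  then show thesis using that D by blast
qed

lemma sampling_guarantee_mono: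
  fixes V :: "'v set"
  assumes "sampling_guarantee A V K f' \<epsilon> \<delta> c D" "c \<le> d"
  shows "sampling_guarantee A V K f' \<epsilon> \<delta> d D"
proof -
  have "c * (real (card (edges G)) / \<epsilon>\<^sup>2 * (\<Sum>l=2..card (vertices A). overlap_term (overlap_frac A G) l))
      \<le> d * (real (card (edges G)) / \<epsilon>\<^sup>2 * (\<Sum>l=2..card (vertices A). overlap_term (overlap_frac A G) l))"
    for G :: "'v ugraph"
    using \<open>c \<le> d\<close> by (intro mult_right_mono mult_nonneg_nonneg sum_nonneg overlap_term_nonneg) auto
  note bound = order_trans[OF _ this]
  show ?thesis
    unfolding sampling_guarantee_def
  proof (intro allI impI conjI)
    fix G :: "'v ugraph"
    assume "simple_graph G" "vertices G = V" "num_copies A G \<ge> 1"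
      "\<forall>l\<in>{1..card (vertices A)}. within_factor K (f' l) (overlap_frac A G l)"
    note guarantee = assms(1)[unfolded sampling_guarantee_def, rule_format, OF this(1-3) this(4)[rule_format]]
    show "1 - \<delta> \<le> measure_pmf.prob (sampler_output D G) {X. within_factor (1 + \<epsilon>) X (real (num_copies A G))}"
      using guarantee by blast
    show "expected_samples D G \<le> d * (real (card (edges G)) / \<epsilon>\<^sup>2 *
        (\<Sum>l=2..card (vertices A). overlap_term (overlap_frac A G) l))"
      using guarantee by (intro bound) blast
  qed
qed

text \<open>As \<open>\<delta>\<close> tends to \<open>1\<close>, the budget \<open>ln (1 / \<delta>)\<close> tends to \<open>0\<close>. For \<open>\<delta> > 1 / 2\<close> the sampler with
  failure probability \<open>1 / 2\<close> is therefore only run with probability \<open>2 * (1 - \<delta>)\<close>.\<close>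

lemma sampling_guarantee_any_delta:
  fixes A :: "'a ugraph" and V :: "'v set"
  assumes "finite V" "card (vertices A) = s" "s \<ge> 2" "K \<ge> 1" "0 < \<epsilon>" "\<epsilon> < K" "0 < \<delta>" "\<delta> < 1"
    and "\<And>l. l \<in> {1..s} \<Longrightarrow> 0 \<le> f' l" "f' s > 0"
  obtains D :: "'v sampler" where "sampling_algorithm V D"
    and "sampling_guarantee A V K f' \<epsilon> \<delta> (64 * K\<^sup>2 * (2 + K)\<^sup>2 * (16 * real s + 1) * ln (1 / \<delta>)) D"
proof -
  define C where "C = 32 * K\<^sup>2 * (2 + K)\<^sup>2 * (16 * real s + 1)"
  have C: "C \<ge> 0" "64 * K\<^sup>2 * (2 + K)\<^sup>2 * (16 * real s + 1) = 2 * C" by (auto simp: C_def)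
  have "ln (1 / \<delta>) \<ge> 0" using assms by simp
  show thesis
  proof (cases "\<delta> \<le> 1 / 2")
    case True
    then obtain D :: "'v sampler" where D: "sampling_algorithm V D"
      "sampling_guarantee A V K f' \<epsilon> \<delta> (C * ln (1 / \<delta>)) D"
      using sampling_guarantee_small_delta[of V A s K \<epsilon> \<delta> f'] assms unfolding C_def by metis
    moreover have "C * ln (1 / \<delta>) \<le> 2 * C * ln (1 / \<delta>)"
      using C \<open>ln (1 / \<delta>) \<ge> 0\<close> by simp
    ultimately show thesis using that sampling_guarantee_mono unfolding C(2) by blast
  next
    case False
    obtain D :: "'v sampler" where D: "sampling_algorithm V D" "finite (set_pmf D)"
      "sampling_guarantee A V K f' \<epsilon> (1 / 2) (C * ln (1 / (1 / 2))) D"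
      using sampling_guarantee_small_delta[of V A s K \<epsilon> "1 / 2" f'] assms unfolding C_def
      by (metis half_gt_zero_iff order_refl zero_less_one)
    \<comment> \<open>Chosen so that \<open>p\<close> times the success probability
      \<open>1 / 2\<close> is exactly \<open>1 - \<delta>\<close>.\<close>
    define p where "p = 2 * (1 - \<delta>)"
    have p: "0 \<le> p" "p \<le> 1" "1 - p * (1 - 1 / 2) = \<delta>" using False assms by (auto simp: p_def field_simps)
    obtain D' where D': "sampling_algorithm V D'"
      "sampling_guarantee A V K f' \<epsilon> \<delta> (p * (C * ln (1 / (1 / 2)))) D'"
      using sampling_guarantee_thin[OF D(3,1,2) p(1,2)] unfolding p(3) by metis
    \<comment> \<open>The thinned cost is proportional to \<open>(1 - \<delta>) * ln 2\<close>, and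
      \<open>1 - \<delta> \<le> ln (1 / \<delta>)\<close> brings it under the required budget even
      as \<delta> tends to 1.\<close>
    have "ln \<delta> \<le> \<delta> - 1" using \<open>0 < \<delta>\<close> by (rule ln_le_minus_one)
    then have "1 - \<delta> \<le> ln (1 / \<delta>)" using \<open>0 < \<delta>\<close> by (simp add: ln_div)
    moreover have "ln 2 \<le> (1::real)" using ln_le_minus_one[of "2::real"] by simp
    ultimately have "(1 - \<delta>) * ln 2 \<le> ln (1 / \<delta>) * 1"
      using assms by (intro mult_mono) auto
    then have "2 * C * ((1 - \<delta>) * ln 2) \<le> 2 * C * ln (1 / \<delta>)"
      using C by (intro mult_left_mono) auto
    then have "p * (C * ln (1 / (1 / 2))) \<le> 2 * C * ln (1 / \<delta>)"
      by (simp add: p_def algebra_simps)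
    then show thesis using that D' sampling_guarantee_mono unfolding C(2) by blast
  qed
qed

section \<open>Degenerate cases and the final bound\<close>

lemma constant_sampler:
  shows "sampling_algorithm V (return_pmf ({}, \<lambda>_. x))"
    and "expected_samples (return_pmf ({}, \<lambda>_. x)) G = 0"
    and "sampler_output (return_pmf ({}, \<lambda>_. x)) G = return_pmf x"
  by (auto simp: sampling_algorithm_def expected_samples_def sampler_output_def)

text \<open>The advice \<open>M'\<close> and \<open>f'\<close> expresses that the sampler knows the
  parameters up to the factor \<open>K\<close>; it is fixed before \<open>D\<close>, and
  \<open>G\<close> comes last. \<open>max 1\<close> keeps the budget from vanishing at
  \<open>M = 1\<close>, where the logarithm is 0.\<close>

theorem mainTheorem3:
  fixes A :: "'a ugraph" and s :: nat and K :: real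
  assumes "simple_graph A" and "card (vertices A) = s" and "K \<ge> 1"
  shows "\<exists>C>0. \<forall>(V :: 'v set) (\<epsilon> :: real) (\<delta> :: real) (M' :: real) (f' :: nat \<Rightarrow> real).
    finite V \<longrightarrow> 0 < \<epsilon> \<longrightarrow> 0 < \<delta> \<longrightarrow> \<delta> < 1 \<longrightarrow>
    (\<exists>D :: 'v sampler. sampling_algorithm V D \<and>
      (\<forall>G :: 'v ugraph.
        let m = real (card (edges G)); M = real (num_copies A G); f = overlap_frac A G in
        simple_graph G \<longrightarrow> vertices G = V \<longrightarrow> M \<ge> 1 \<longrightarrow>
        within_factor K M' M \<longrightarrow> (\<forall>l\<in>{1..s}. within_factor K (f' l) (f l)) \<longrightarrow>
        measure_pmf.prob (sampler_output D G) {X. within_factor (1 + \<epsilon>) X M} \<ge> 1 - \<delta> \<and>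
        expected_samples D G \<le>
          C * (m * (ln (1 / \<delta>) / \<epsilon>\<^sup>2) * max 1 (log 2 M) *
            (\<Sum>l=2..s. rpow (f l) (2 / real l)
               + rpow (f l) (1 / (real l - 1)) * rpow (f 1) (1 - 1 / (real l - 1))))))"
proof -
  define C where "C = 64 * K\<^sup>2 * (2 + K)\<^sup>2 * (16 * real s + 1)"
  have "C > 0" using \<open>K \<ge> 1\<close> by (auto simp: C_def intro!: mult_pos_pos add_nonneg_pos)
  show ?thesis
    unfolding Let_def overlap_term_def[symmetric]
  proof (intro exI[of _ C] conjI \<open>C > 0\<close> allI impI)
    fix V :: "'v set" and \<epsilon> \<delta> M' :: real and f' :: "nat \<Rightarrow> real"
    assume V: "finite V" and \<epsilon>: "0 < \<epsilon>" and \<delta>: "0 < \<delta>" "\<delta> < 1"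
    have "ln (1 / \<delta>) \<ge> 0" using \<delta> by simp
    let ?budget = "\<lambda>G. C * (real (card (edges G)) * (ln (1 / \<delta>) / \<epsilon>\<^sup>2)
        * max 1 (log 2 (real (num_copies A G))) * (\<Sum>l=2..s. overlap_term (overlap_frac A G) l))"
    have budget_nonneg: "?budget G \<ge> 0" for G
      using \<open>C > 0\<close> \<open>ln (1 / \<delta>) \<ge> 0\<close> by (intro mult_nonneg_nonneg sum_nonneg overlap_term_nonneg) auto
    let ?valid = "\<lambda>G. simple_graph G \<and> vertices G = V \<and> 1 \<le> real (num_copies A G)
        \<and> within_factor K M' (real (num_copies A G))
        \<and> (\<forall>l\<in>{1..s}. within_factor K (f' l) (overlap_frac A G l))"
    let ?goal = "\<lambda>D G. measure_pmf.prob (sampler_output D G) {X. within_factor (1 + \<epsilon>) X (real (num_copies A G))}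
        \<ge> 1 - \<delta> \<and> expected_samples D G \<le> ?budget G"
    \<comment> \<open>A constant answer uses no samples, so it suffices whenever one number is
      accurate for all valid graphs at once.\<close>
    have const: "\<exists>D. sampling_algorithm V D \<and> (\<forall>G. ?valid G \<longrightarrow> ?goal D G)"
      if "\<And>G. ?valid G \<Longrightarrow> within_factor (1 + \<epsilon>) x (real (num_copies A G))" for x
    proof (intro exI[of _ "return_pmf ({}, \<lambda>_. x)"] conjI allI impI)
      show "sampling_algorithm V (return_pmf ({}, \<lambda>_. x))" by (rule constant_sampler)
      fix G :: "'v ugraph" assume "?valid G"
      then show "measure_pmf.prob (sampler_output (return_pmf ({}, \<lambda>_. x)) G)
          {X. within_factor (1 + \<epsilon>) X (real (num_copies A G))} \<ge> 1 - \<delta>"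
        using that \<delta> by (simp add: constant_sampler)
      show "expected_samples (return_pmf ({}, \<lambda>_. x)) G \<le> ?budget G"
        using budget_nonneg by (simp add: constant_sampler(2))
    qed
    have "K \<le> 1 + \<epsilon> \<or> \<epsilon> < K" "s \<le> 1 \<or> 2 \<le> s" by linarith+
    then consider (no_input) "\<nexists>G. ?valid G" | (large_error) "K \<le> 1 + \<epsilon>" | (trivial) "s \<le> 1"
      | (main) G where "?valid G" "\<epsilon> < K" "s \<ge> 2"
      by blast
    then have "\<exists>D. sampling_algorithm V D \<and> (\<forall>G. ?valid G \<longrightarrow> ?goal D G)"
    proof cases
      case no_input
      then show ?thesis by (intro const) blast
    next
      case large_error
      show ?thesis
      proof (rule const)
        fix G :: "'v ugraph" assume "?valid G"
        then have "within_factor K M' (real (num_copies A G))" by blast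
        then show "within_factor (1 + \<epsilon>) M' (real (num_copies A G))"
          by (rule within_factor_mono) (use large_error \<open>K \<ge> 1\<close> in auto)
      qed
    next
      case trivial
      show ?thesis
      proof (rule const)
        fix G :: "'v ugraph" assume "?valid G"
        then have "num_copies A (V, {}) = num_copies A G"
          using copies_no_edges[of A G] trivial assms by (simp add: num_copies_def)
        then show "within_factor (1 + \<epsilon>) (real (num_copies A (V, {}))) (real (num_copies A G))"
          using \<epsilon> by (simp add: within_factor_def divide_le_eq algebra_simps)
      qed
    next
      \<comment> \<open>The fixed valid graph serves only to show that the advice is nonnegative and
        \<open>f' s\<close> positive; the resulting sampler works for every valid graph.\<close>
      case main
      have f'_ge: "overlap_frac A G l / K \<le> f' l" if "l \<in> {1..s}" for l
        using main(1) that by (auto simp: within_factor_def)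
      have "0 \<le> f' l" if "l \<in> {1..s}" for l
        using f'_ge[OF that] overlap_frac_bounds(1)[of G A l] main(1) \<open>K \<ge> 1\<close>
        by (meson divide_nonneg_nonneg order_trans zero_le_one)
      moreover have "f' s > 0"
      proof -
        have "overlap_frac A G s / K > 0"
          using overlap_frac_full_pos[of G A] main(1) assms by simp
        then show ?thesis using f'_ge[of s] main(3) by simp
      qed
      ultimately obtain D :: "'v sampler" where D: "sampling_algorithm V D"
        "sampling_guarantee A V K f' \<epsilon> \<delta> (C * ln (1 / \<delta>)) D"
        using sampling_guarantee_any_delta[OF V \<open>card (vertices A) = s\<close> main(3) \<open>K \<ge> 1\<close> \<epsilon> main(2) \<delta>, of f']
        unfolding C_def by metis
      have "?goal D G" if "?valid G" for G
      proof -
        let ?x = "real (card (edges G)) / \<epsilon>\<^sup>2 * (\<Sum>l=2..s. overlap_term (overlap_frac A G) l)"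
        have "?x \<ge> 0" by (intro mult_nonneg_nonneg sum_nonneg overlap_term_nonneg) auto
        then have "C * ln (1 / \<delta>) * ?x * 1 \<le> C * ln (1 / \<delta>) * ?x * max 1 (log 2 (real (num_copies A G)))"
          using \<open>C > 0\<close> \<open>ln (1 / \<delta>) \<ge> 0\<close> by (intro mult_left_mono mult_nonneg_nonneg[OF _ \<open>?x \<ge> 0\<close>]) auto
        also have "\<dots> = ?budget G" by (simp add: mult_ac)
        finally have "C * ln (1 / \<delta>) * ?x \<le> ?budget G" by simp
        moreover have "simple_graph G" "vertices G = V" "num_copies A G \<ge> 1"
          "\<And>l. l \<in> {1..s} \<Longrightarrow> within_factor K (f' l) (overlap_frac A G l)"
          using that by auto
        note D(2)[unfolded sampling_guarantee_def \<open>card (vertices A) = s\<close>, rule_format, OF this]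
        ultimately show ?thesis by linarith
      qed
      then show ?thesis using D(1) by blast
    qed
    then show "\<exists>D. sampling_algorithm V D \<and> (\<forall>G. simple_graph G \<longrightarrow> vertices G = V \<longrightarrow>
        1 \<le> real (num_copies A G) \<longrightarrow> within_factor K M' (real (num_copies A G)) \<longrightarrow>
        (\<forall>l\<in>{1..s}. within_factor K (f' l) (overlap_frac A G l)) \<longrightarrow> ?goal D G)"
      by blast
  qed
qed

end
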